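(* Let $G$ be a locally compact second countable group and $\mu\in\mathrm{Prob}(G)$ an admissible measure. Let $(X,\nu_X)$ and $(Y,\nu_Y)$ be compact metrizable $(G,\mu)$-spaces. Assume that there exists a quasi-factor map, i.e., a $G$-equivariant measurable map $\beta:Y\to\mathrm{Prob}(X)$, $y\mapsto\beta_y$, with $\nu_X=\int_Y\beta_y\,d\nu_Y(y)$. Then $$h_\mu(X,\nu_X)\leq h_\mu(Y,\nu_Y).$$ Assume moreover that $h_\mu(Y,\nu_Y)<+\infty$. Then equality holds if and only if $\beta$ induces a measure preserving $G$-equivariant isomorphism $\beta_{\mathrm{RN}}:(Y_{\mathrm{RN}},\nu_{Y_{\mathrm{RN}}})\to(X_{\mathrm{RN}},\nu_{X_{\mathrm{RN}}})$ between the Radon-Nikodym factors such that $$\pi_{X_{\mathrm{RN}}*}(\beta_y)=\delta_{\beta_{\mathrm{RN}}(\pi_{Y_{\mathrm{RN}}}(y))}\quad\text{for }\nu_Y\text{-a.e. }y\in Y.$$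
   Context: Admissible: there exists $k\ge1$ such that $\mu^{*k}$ is absolutely continuous with respect to the left Haar measure of $G$, and $\bigcup_{n\ge1}(\operatorname{supp}\mu)^n=G$. A $(G,\mu)$-space $(X,\nu_X)$ is a (standard) nonsingular probability $G$-space whose measure is $\mu$-stationary: $\mu*\nu_X=\nu_X$. It is compact metrizable if $X$ is a compact metrizable space with continuous $G$-action and $\nu_X$ a Borel probability measure. $\mathrm{Prob}(X)$ is the space of Borel probability measures on $X$ with the push-forward $G$-action. Equivariance and equalities of measurable maps are understood modulo null sets, as usual. Furstenberg entropy: $h_\mu(X,\nu_X)=-\int_G\int_X\log\frac{dg^{-1}\nu_X}{d\nu_X}(x)\,d\nu_X(x)\,d\mu(g)\in[0,+\infty]$. Radon-Nikodym factor: $(X_{\mathrm{RN}},\nu_{X_{\mathrm{RN}}})$ is the unique $G$-factor of $(X,\nu_X)$ whose completed $\sigma$-algebra is the minimal (complete) sub-$\sigma$-algebra of $\overline\Sigma_X$ making all $\frac{dg\nu_X}{d\nu_X}$, $g\in G$, measurable; equivalently $L^\infty(X_{\mathrm{RN}})\subset L^\infty(X)$ is the von Neumann subalgebra generated by $\{(\frac{dg\nu_X}{d\nu_X})^{it}\}_{g\in G,t\in\mathbb{R}}$. The factor map is $\pi_{X_{\mathrm{RN}}}:(X,\nu_X)\to(X_{\mathrm{RN}},\nu_{X_{\mathrm{RN}}})$, and $\pi_{X_{\mathrm{RN}}*}$ denotes push-forward of probability measures. $\delta_x$ is the Dirac mass at $x$. *)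

theory Defs
  imports "HOL-Probability.Probability"
begin

section \<open>Groups and actions\<close>

text \<open>
  A topological group is rendered by the type class of topological groups in additive notation.
  Commutativity is not part of that class: \<open>g + h\<close> is the product, \<open>0\<close> the unit and
  \<open>- g\<close> the inverse. All measures below are Borel measures, so \<open>distr \<nu> borel (act g)\<close> is
  the translate \<open>g\<nu>\<close>, that is \<open>(g\<nu>)(A) = \<nu>(g\<^sup>-\<^sup>1 A)\<close>.
\<close>

definition is_action :: "('g::group_add \<Rightarrow> 'x \<Rightarrow> 'x) \<Rightarrow> bool" where
  "is_action act \<longleftrightarrow>
     (\<forall>x. act 0 x = x) \<and> (\<forall>g h x. act (g + h) x = act g (act h x))"

definition conv_measure ::
  "('g::topological_space \<Rightarrow> 'x::topological_space \<Rightarrow> 'x) \<Rightarrow> 'g measure \<Rightarrow> 'x measure \<Rightarrow> 'x measure" where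
  "conv_measure act \<mu> \<nu> = distr (\<mu> \<Otimes>\<^sub>M \<nu>) borel (\<lambda>(g, x). act g x)"

fun conv_power :: "'g::topological_group_add measure \<Rightarrow> nat \<Rightarrow> 'g measure" where
  "conv_power \<mu> 0 = return borel 0"
| "conv_power \<mu> (Suc k) = conv_measure (+) \<mu> (conv_power \<mu> k)"

fun set_prod_power :: "'g::group_add set \<Rightarrow> nat \<Rightarrow> 'g set" where
  "set_prod_power A 0 = {0}"
| "set_prod_power A (Suc n) = {a + b | a b. a \<in> A \<and> b \<in> set_prod_power A n}"

definition measure_support :: "'a::topological_space measure \<Rightarrow> 'a set" where
  "measure_support \<mu> = {x. \<forall>U. open U \<longrightarrow> x \<in> U \<longrightarrow> emeasure \<mu> U > 0}"

text \<open>
  On a locally compact second countable Hausdorff group, a Borel measure that is finite on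
  compact sets is automatically regular, so regularity need not be demanded.
\<close>

definition left_haar_measure :: "'g::topological_group_add measure \<Rightarrow> bool" where
  "left_haar_measure m \<longleftrightarrow>
     sets m = sets borel \<and>
     emeasure m UNIV \<noteq> 0 \<and>
     (\<forall>K. compact K \<longrightarrow> emeasure m K < \<infinity>) \<and>
     (\<forall>g. distr m borel (\<lambda>x. g + x) = m)"

definition admissible :: "'g::topological_group_add measure \<Rightarrow> bool" where
  "admissible \<mu> \<longleftrightarrow>
     (\<exists>k\<ge>1. \<exists>m. left_haar_measure m \<and> absolutely_continuous m (conv_power \<mu> k)) \<and>
     (\<Union>n\<in>{1..}. set_prod_power (measure_support \<mu>) n) = UNIV"


section \<open>Nonsingular and stationary spaces\<close>

text \<open>
  Every standard Borel space is Borel isomorphic to a Polish space, and every compact metrizable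
  space is Polish; both are therefore carried by types of class \<open>polish_space\<close>. The particular
  metric plays no role below.
\<close>

definition nonsingular_space ::
  "('g::topological_group_add \<Rightarrow> 'x::polish_space \<Rightarrow> 'x) \<Rightarrow> 'x measure \<Rightarrow> bool" where
  "nonsingular_space act \<nu> \<longleftrightarrow>
     is_action act \<and>
     (\<lambda>(g, x). act g x) \<in> borel_measurable (borel \<Otimes>\<^sub>M borel) \<and>
     sets \<nu> = sets borel \<and> prob_space \<nu> \<and>
     (\<forall>g. absolutely_continuous \<nu> (distr \<nu> borel (act g)) \<and>
          absolutely_continuous (distr \<nu> borel (act g)) \<nu>)"

definition stationary_space ::
  "'g::topological_group_add measure \<Rightarrow> ('g \<Rightarrow> 'x::polish_space \<Rightarrow> 'x) \<Rightarrow> 'x measure \<Rightarrow> bool" where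
  "stationary_space \<mu> act \<nu> \<longleftrightarrow>
     nonsingular_space act \<nu> \<and> conv_measure act \<mu> \<nu> = \<nu>"

definition compact_stationary_space ::
  "'g::topological_group_add measure \<Rightarrow> ('g \<Rightarrow> 'x::polish_space \<Rightarrow> 'x) \<Rightarrow> 'x measure \<Rightarrow> bool" where
  "compact_stationary_space \<mu> act \<nu> \<longleftrightarrow>
     stationary_space \<mu> act \<nu> \<and>
     compact (UNIV :: 'x set) \<and>
     continuous_on UNIV (\<lambda>(g, x). act g x)"

definition equivariant_AE ::
  "('g \<Rightarrow> 'x \<Rightarrow> 'x) \<Rightarrow> 'x measure \<Rightarrow> ('g \<Rightarrow> 'z \<Rightarrow> 'z) \<Rightarrow> ('x \<Rightarrow> 'z) \<Rightarrow> bool" where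
  "equivariant_AE actX \<nu> actZ f \<longleftrightarrow> (\<forall>g. AE x in \<nu>. f (actX g x) = actZ g (f x))"

text \<open>
  The Giry \<sigma>-algebra of \<open>prob_algebra borel\<close> is generated by the evaluations at Borel sets; over
  a compact metrizable space it is the Borel \<sigma>-algebra of the weak-* topology.
\<close>

definition quasi_factor_map ::
  "('g::topological_group_add \<Rightarrow> 'y::polish_space \<Rightarrow> 'y) \<Rightarrow> 'y measure \<Rightarrow>
   ('g \<Rightarrow> 'x::polish_space \<Rightarrow> 'x) \<Rightarrow> 'x measure \<Rightarrow> ('y \<Rightarrow> 'x measure) \<Rightarrow> bool" where
  "quasi_factor_map actY \<nu>Y actX \<nu>X \<beta> \<longleftrightarrow>
     \<beta> \<in> measurable \<nu>Y (prob_algebra borel) \<and>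
     equivariant_AE actY \<nu>Y (\<lambda>g M. distr M borel (actX g)) \<beta> \<and>
     \<nu>X = bind \<nu>Y \<beta>"


section \<open>Furstenberg entropy\<close>

text \<open>
  The Bochner integral is \<open>0\<close> on non-integrable functions, so it cannot express an entropy
  that may be infinite. The integral below is meaningful as soon as the positive or the negative part
  has finite integral. In the inner integral of the entropy the positive part of the logarithm is
  integrable, because it is bounded by the density itself; in the outer one the integrand is
  nonpositive. Since \<open>g\<nu>\<close> and \<open>\<nu>\<close> are equivalent, the density is almost everywhere
  positive and finite, so that taking its real logarithm is harmless.
\<close>

definition ext_integral :: "'a measure \<Rightarrow> ('a \<Rightarrow> ereal) \<Rightarrow> ereal" where
  "ext_integral M f =
     enn2ereal (\<integral>\<^sup>+x. e2ennreal (f x) \<partial>M) - enn2ereal (\<integral>\<^sup>+x. e2ennreal (- f x) \<partial>M)"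

definition furstenberg_entropy ::
  "'g::group_add measure \<Rightarrow> ('g \<Rightarrow> 'x::topological_space \<Rightarrow> 'x) \<Rightarrow> 'x measure \<Rightarrow> ereal" where
  "furstenberg_entropy \<mu> act \<nu> =
     - ext_integral \<mu> (\<lambda>g. ext_integral \<nu>
         (\<lambda>x. ereal (ln (enn2real (RN_deriv \<nu> (distr \<nu> borel (act (- g))) x)))))"


section \<open>Radon--Nikodym factors\<close>

definition complete_sigma :: "'a measure \<Rightarrow> 'a set set \<Rightarrow> 'a set set" where
  "complete_sigma M S = sigma_sets (space M) (S \<union> null_sets (completion M))"

definition RN_sigma ::
  "('g \<Rightarrow> 'x::topological_space \<Rightarrow> 'x) \<Rightarrow> 'x measure \<Rightarrow> 'x set set" where
  "RN_sigma act \<nu> = complete_sigma \<nu>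
     {RN_deriv \<nu> (distr \<nu> borel (act g)) -` B | g B. B \<in> sets borel}"

definition factor_map ::
  "('g::topological_group_add \<Rightarrow> 'x::polish_space \<Rightarrow> 'x) \<Rightarrow> 'x measure \<Rightarrow>
   ('g \<Rightarrow> 'z::polish_space \<Rightarrow> 'z) \<Rightarrow> 'z measure \<Rightarrow> ('x \<Rightarrow> 'z) \<Rightarrow> bool" where
  "factor_map actX \<nu>X actZ \<nu>Z p \<longleftrightarrow>
     p \<in> measurable \<nu>X borel \<and>
     distr \<nu>X borel p = \<nu>Z \<and>
     equivariant_AE actX \<nu>X actZ p"

text \<open>
  The Radon--Nikodym factor is unique only up to isomorphism. The following predicate says that
  \<open>(Z, \<nu>Z)\<close> with the map \<open>p\<close> is a model of it.
\<close>

definition RN_factor ::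
  "('g::topological_group_add \<Rightarrow> 'x::polish_space \<Rightarrow> 'x) \<Rightarrow> 'x measure \<Rightarrow>
   ('g \<Rightarrow> 'z::polish_space \<Rightarrow> 'z) \<Rightarrow> 'z measure \<Rightarrow> ('x \<Rightarrow> 'z) \<Rightarrow> bool" where
  "RN_factor actX \<nu>X actZ \<nu>Z p \<longleftrightarrow>
     nonsingular_space actZ \<nu>Z \<and>
     factor_map actX \<nu>X actZ \<nu>Z p \<and>
     complete_sigma \<nu>X {p -` B | B. B \<in> sets borel} = RN_sigma actX \<nu>X"

definition factor_isomorphism ::
  "('g::topological_group_add \<Rightarrow> 'z::polish_space \<Rightarrow> 'z) \<Rightarrow> 'z measure \<Rightarrow>
   ('g \<Rightarrow> 'w::polish_space \<Rightarrow> 'w) \<Rightarrow> 'w measure \<Rightarrow> ('z \<Rightarrow> 'w) \<Rightarrow> bool" where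
  "factor_isomorphism actZ \<nu>Z actW \<nu>W b \<longleftrightarrow>
     factor_map actZ \<nu>Z actW \<nu>W b \<and>
     (\<exists>c. factor_map actW \<nu>W actZ \<nu>Z c \<and>
          (AE z in \<nu>Z. c (b z) = z) \<and> (AE w in \<nu>W. b (c w) = w))"

end

theory Submission
  imports Defs
begin

text \<open>
  Let \<open>\<lambda> = \<integral> \<delta>\<^sub>y \<otimes> \<beta>\<^sub>y d\<nu>\<^sub>Y(y)\<close>, a measure on \<open>Y \<times> X\<close> with marginals \<open>\<nu>\<^sub>Y\<close> and \<open>\<nu>\<^sub>X\<close>, and write
  \<open>r\<^sub>g(y)\<close>, \<open>s\<^sub>g(x)\<close> for the densities of \<open>g\<nu>\<^sub>Y\<close>, \<open>g\<nu>\<^sub>X\<close>. By equivariance \<open>g\<lambda>\<close> has density \<open>r\<^sub>g(y)\<close>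
  with respect to \<open>\<lambda>\<close>, so \<open>s\<^sub>g\<close> is the conditional expectation of \<open>r\<^sub>g\<close>. With the nonnegative function
  \<open>\<phi>(t) = t - 1 - ln t\<close> the entropy is the \<open>\<mu>\<close>-average of \<open>\<integral> \<phi>(r\<^sub>g) d\<nu>\<^sub>Y\<close> over \<open>g\<^sup>-\<^sup>1\<close>, and
  \<open>\<integral> \<phi>(r\<^sub>g) d\<nu>\<^sub>Y = \<integral> \<phi>(s\<^sub>g) d\<nu>\<^sub>X + \<integral> \<phi>(r\<^sub>g / s\<^sub>g) d\<lambda>\<close>, which gives the inequality.

  If equality holds and the entropy is finite, then \<open>r\<^sub>g(y) = s\<^sub>g(x)\<close> almost everywhere for \<open>\<mu>\<close>-almost
  every \<open>g\<close>. By the cocycle identity the set of all such \<open>g\<close> is a subgroup. It has full measure for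
  the convolution powers of \<open>\<mu>\<close>, hence positive Haar measure, so it is open by Steinhaus; being
  open, it contains the support of \<open>\<mu>\<close> and therefore is \<open>G\<close>. Modulo \<open>\<lambda>\<close>-null sets the two Radon--Nikodym
  \<open>\<sigma>\<close>-algebras then coincide, so each of \<open>\<pi>\<^sub>X(x)\<close> and \<open>\<pi>\<^sub>Y(y)\<close> is a function of the other. Conversely,
  if they are, then \<open>r\<^sub>g(y)\<close> is a function of \<open>x\<close> and must equal its conditional expectation \<open>s\<^sub>g(x)\<close>.
\<close>

section \<open>Translations and Haar measure\<close>

lemma haar_vimage:
  fixes m :: "'g::{topological_group_add, second_countable_topology} measure"
  assumes "left_haar_measure m" "A \<in> sets borel"
  shows "emeasure m ((\<lambda>x. g + x) -` A) = emeasure m A"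
proof -
  have [measurable_cong]: "sets m = sets borel" and inv: "distr m borel (\<lambda>x. g + x) = m"
    using assms(1) by (auto simp: left_haar_measure_def)
  have sp: "space m = UNIV" using sets_eq_imp_space_eq[OF \<open>sets m = sets borel\<close>] by simp
  have "(\<lambda>x. g + x) \<in> borel_measurable m"
    by (subst measurable_cong_sets[OF \<open>sets m = sets borel\<close> refl]) (intro borel_measurable_continuous_onI continuous_intros)
  then show ?thesis
    using emeasure_distr[of "\<lambda>x. g + x" m borel A] assms(2) sp by (simp add: inv)
qed

text \<open>Haar measure may be infinite, while the arguments below compare real-valued measures
  inside a window of finite measure. Local compactness puts an open window inside a compact set
  around every point, and Lindelof leaves countably many.\<close>

lemma haar_finite_open_cover:
  fixes m :: "'g::{topological_group_add, t2_space, second_countable_topology} measure"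
  assumes "left_haar_measure m" "locally_compact_space (euclidean :: 'g topology)"
  obtains \<W> where "countable \<W>" "\<Union>\<W> = UNIV" "\<And>W. W \<in> \<W> \<Longrightarrow> open W \<and> emeasure m W < \<infinity>"
proof -
  have sm: "sets m = sets borel" using assms by (auto simp: left_haar_measure_def)
  let ?F = "{W. open W \<and> emeasure m W < \<infinity>}"
  have "\<exists>W\<in>?F. x \<in> W" for x
  proof -
    obtain U K where "openin euclidean U" "compactin euclidean K" "x \<in> U" "U \<subseteq> K"
      using assms(2)[unfolded locally_compact_space_def, THEN bspec, of x] by auto
    then have UK: "open U" "compact K" by simp_all
    have "emeasure m U \<le> emeasure m K"
      using UK \<open>U \<subseteq> K\<close> sm by (intro emeasure_mono) (auto intro: compact_imp_closed borel_closed)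
    also have "\<dots> < \<infinity>" using assms(1) UK by (auto simp: left_haar_measure_def)
    finally show ?thesis using \<open>x \<in> U\<close> UK by auto
  qed
  then have cov: "\<Union>?F = UNIV" by auto
  obtain \<W> where "\<W> \<subseteq> ?F" "countable \<W>" "\<Union>\<W> = \<Union>?F"
    using Lindelof[of ?F] by auto
  show ?thesis
  proof (rule that)
    show "countable \<W>" "\<Union>\<W> = UNIV" by (fact, simp only: \<open>\<Union>\<W> = \<Union>?F\<close> cov)
    show "open W \<and> emeasure m W < \<infinity>" if "W \<in> \<W>" for W using that \<open>\<W> \<subseteq> ?F\<close> by auto
  qed
qed

context
  fixes m :: "'g::{topological_group_add, t2_space, second_countable_topology} measure"
    and g :: "nat \<Rightarrow> 'g"
  assumes haar: "left_haar_measure m" and g0: "g \<longlonglongrightarrow> 0"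
begin

lemma haar_sets: "sets m = sets borel"
  using haar by (auto simp: left_haar_measure_def)

lemma haar_space: "space m = UNIV"
  using sets_eq_imp_space_eq[OF haar_sets] by simp

lemma translate_vimage_sets: "A \<in> sets borel \<Longrightarrow> (\<lambda>x. (h::'g) + x) -` A \<in> sets borel"
  using measurable_sets[of "\<lambda>x. h + x" borel borel A]
  by (auto intro!: borel_measurable_continuous_onI continuous_intros)

text \<open>If \<open>x\<close> lies in the open set \<open>U\<close>, then so does
  \<open>g n + x\<close> eventually. Hence the indicators of the overlaps converge pointwise,
  dominated by the indicator of \<open>U\<close>.\<close>

lemma haar_open_overlap:
  assumes U: "open U" "emeasure m U < \<infinity>"
  shows "(\<lambda>n. measure m (U \<inter> (\<lambda>x. g n + x) -` U)) \<longlonglongrightarrow> measure m U"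
proof -
  have Us: "U \<in> sets borel" using U by auto
  let ?V = "\<lambda>n. U \<inter> (\<lambda>x. g n + x) -` U"
  have Vs: "?V n \<in> sets m" for n
    using translate_vimage_sets[OF Us] Us haar_sets by auto
  have "(\<lambda>n. integral\<^sup>L m (indicator (?V n) :: _ \<Rightarrow> real)) \<longlonglongrightarrow> integral\<^sup>L m (indicator U)"
  proof (rule integral_dominated_convergence[where w="indicator U"])
    show "integrable m (indicator U :: _ \<Rightarrow> real)"
      using U Us haar_sets by (auto intro!: integrable_real_indicator)
    show "AE x in m. (\<lambda>n. indicator (?V n) x :: real) \<longlonglongrightarrow> indicator U x"
    proof (rule AE_I2)
      fix x
      show "(\<lambda>n. indicator (?V n) x :: real) \<longlonglongrightarrow> indicator U x"
      proof (cases "x \<in> U")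
        case True
        have "(\<lambda>n. g n + x) \<longlonglongrightarrow> 0 + x" by (intro tendsto_intros g0)
        then have "eventually (\<lambda>n. g n + x \<in> U) sequentially"
          using U True by (auto dest: topological_tendstoD)
        then show ?thesis
          by (intro tendsto_eventually) (auto elim!: eventually_mono simp: True)
      qed simp
    qed
  qed (use Us Vs haar_sets in \<open>auto simp: indicator_def\<close>)
  then show ?thesis using haar_space by simp
qed

text \<open>So far only open sets are known to move continuously, whereas \<open>E\<close> is an
  arbitrary Borel set. Left invariance shifts the translation from \<open>E\<close> to
  \<open>U\<close>, and the error is at most the part of \<open>U\<close> lost in the overlap with
  its translate.\<close>

lemma haar_open_translate:
  assumes U: "open U" "emeasure m U < \<infinity>" and E: "E \<in> sets borel"
  shows "(\<lambda>n. measure m (U \<inter> (\<lambda>x. - g n + x) -` E)) \<longlonglongrightarrow> measure m (U \<inter> E)"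
proof -
  have Us: "U \<in> sets borel" using U by auto
  define V where "V n = (\<lambda>x. g n + x) -` U" for n
  have Vs: "V n \<in> sets m" for n
    using translate_vimage_sets[OF Us] haar_sets by (auto simp: V_def)
  have Vm: "emeasure m (V n) = emeasure m U" for n
    using haar_vimage[OF haar Us] by (simp add: V_def)
  have fmV: "V n \<in> fmeasurable m" for n using Vs Vm U by (auto intro: fmeasurableI)
  have fmU: "U \<in> fmeasurable m" using Us haar_sets U by (auto intro: fmeasurableI)
  have Es: "E \<in> sets m" using E haar_sets by simp
  have eq: "measure m (U \<inter> (\<lambda>x. - g n + x) -` E) = measure m (V n \<inter> E)" for n
  proof -
    have "(\<lambda>x. g n + x) -` (U \<inter> (\<lambda>x. - g n + x) -` E) = V n \<inter> E"
      by (auto simp: V_def add.assoc[symmetric])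
    then show ?thesis
      using haar_vimage[OF haar, of "U \<inter> (\<lambda>x. - g n + x) -` E" "g n"] translate_vimage_sets[OF E] Us
      by (simp add: measure_def)
  qed
  have bd: "\<bar>measure m (V n \<inter> E) - measure m (U \<inter> E)\<bar> \<le> measure m U - measure m (U \<inter> V n)" for n
  proof -
    have le1: "measure m (A \<inter> E) \<le> measure m (A \<inter> B \<inter> E) + (measure m A - measure m (A \<inter> B))"
      if A: "A \<in> fmeasurable m" and B: "B \<in> fmeasurable m" for A B
    proof -
      have "measure m (A \<inter> E) \<le> measure m ((A \<inter> B \<inter> E) \<union> (A - B))"
        using A B Es by (intro measure_mono_fmeasurable) (auto intro: fmeasurable_Int_fmeasurable fmeasurable.Un)
      also have "\<dots> \<le> measure m (A \<inter> B \<inter> E) + measure m (A - B)"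
        using A B Es by (intro measure_Un_le) auto
      also have "measure m (A - B) = measure m (A - A \<inter> B)" by (simp add: Diff_Int)
      also have "\<dots> = measure m A - measure m (A \<inter> B)"
        using A B by (intro measurable_measure_Diff) auto
      finally show ?thesis .
    qed
    have le2: "measure m (A \<inter> B \<inter> E) \<le> measure m (B \<inter> E)"
      if A: "A \<in> fmeasurable m" and B: "B \<in> fmeasurable m" for A B
      using A B Es by (intro measure_mono_fmeasurable) (auto intro: fmeasurable_Int_fmeasurable)
    have mV: "measure m (V n) = measure m U" using Vm by (simp add: measure_def)
    show ?thesis
      using le1[OF fmU fmV, of n] le2[OF fmU fmV, of n] le1[OF fmV fmU, of n] le2[OF fmV fmU, of n] mV
      by (simp add: Int_commute)
  qed
  have "(\<lambda>n. measure m (U \<inter> V n)) \<longlonglongrightarrow> measure m U"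
    unfolding V_def by (rule haar_open_overlap[OF U])
  then have lim: "(\<lambda>n. measure m U - measure m (U \<inter> V n)) \<longlonglongrightarrow> 0"
    using tendsto_diff[OF tendsto_const[of "measure m U"], of _ "measure m U"] by simp
  have "(\<lambda>n. measure m (V n \<inter> E) - measure m (U \<inter> E)) \<longlonglongrightarrow> 0"
    by (rule Lim_null_comparison[OF _ lim]) (simp add: bd)
  then show ?thesis unfolding eq by (simp add: LIM_zero_iff)
qed

text \<open>For fixed \<open>E\<close> the sets \<open>A\<close> with this convergence form a Dynkin
  system containing the open sets, since everything compared lies in the window \<open>W\<close> of
  finite measure. The Steinhaus argument takes \<open>A = E\<close>.\<close>

lemma haar_borel_translate:
  assumes W: "open W" "emeasure m W < \<infinity>" and E: "E \<in> sets borel" and A: "A \<in> sets borel"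
  shows "(\<lambda>n. measure m (A \<inter> W \<inter> (\<lambda>x. - g n + x) -` E)) \<longlonglongrightarrow> measure m (A \<inter> W \<inter> E)"
proof -
  define X where "X n = W \<inter> (\<lambda>x. - g n + x) -` E" for n
  have Ws: "W \<in> sets borel" using W by auto
  have fmW: "W \<in> fmeasurable m" using Ws haar_sets W by (auto intro: fmeasurableI)
  have Xs: "X n \<in> sets m" for n using translate_vimage_sets[OF E] Ws haar_sets by (auto simp: X_def)
  have fmX: "X n \<in> fmeasurable m" for n
    by (rule fmeasurableI2[OF fmW _ Xs]) (auto simp: X_def)
  have fmWE: "W \<inter> E \<in> fmeasurable m"
    using E haar_sets by (intro fmeasurable_Int_fmeasurable fmW) auto
  have "(\<lambda>n. measure m (A \<inter> X n)) \<longlonglongrightarrow> measure m (A \<inter> (W \<inter> E))"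
  proof -
    have "A \<in> sigma_sets UNIV {S. open S}" using A by (simp add: borel_def)
    then show ?thesis
    proof (induct rule: sigma_sets_induct_disjoint[rotated 2, consumes 1, case_names basic empty compl union Int_stable closed])
      case (basic A)
      then have "open (A \<inter> W)" using W by auto
      moreover have "emeasure m (A \<inter> W) < \<infinity>"
        using emeasure_mono[of "A \<inter> W" W m] Ws haar_sets W(2) by (auto intro: le_less_trans)
      ultimately show ?case using haar_open_translate[OF _ _ E, of "A \<inter> W"] by (simp add: X_def Int_assoc)
    next
      case empty then show ?case by simp
    next
      case (compl A)
      then have As: "A \<in> sets m" using haar_sets by (simp add: borel_def)
      have d: "measure m ((UNIV - A) \<inter> B) = measure m B - measure m (A \<inter> B)" if "B \<in> fmeasurable m" for B
      proof -
        have "(UNIV - A) \<inter> B = B - A \<inter> B" by auto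
        then show ?thesis using that As
          by (simp add: measure_Diff fmeasurableD fmeasurable_Int_fmeasurable Int_commute fmeasurableD2)
      qed
      have "(\<lambda>n. measure m (X n)) \<longlonglongrightarrow> measure m (W \<inter> E)"
        unfolding X_def by (intro haar_open_translate W E)
      then show ?case using compl by (auto simp: d fmX fmWE intro!: tendsto_diff)
    next
      case (union A)
      then have As: "A i \<in> sets m" for i using haar_sets by (auto simp: borel_def)
      have su: "(\<lambda>i. measure m (A i \<inter> B)) sums measure m ((\<Union>i. A i) \<inter> B)" if "B \<in> fmeasurable m" for B
      proof -
        have "(\<lambda>i. measure m (A i \<inter> B)) sums measure m (\<Union>i. A i \<inter> B)"
        proof (rule measure_UNION)
          show "disjoint_family (\<lambda>i. A i \<inter> B)" using union by (auto simp: disjoint_family_on_def)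
          show "range (\<lambda>i. A i \<inter> B) \<subseteq> sets m" using As that by (auto dest: fmeasurableD)
          have "(\<Union>i. A i \<inter> B) \<in> fmeasurable m"
            using that As by (intro fmeasurableI2[OF that]) auto
          then show "emeasure m (\<Union>i. A i \<inter> B) \<noteq> \<infinity>" by (auto simp: fmeasurableD2)
        qed
        then show ?thesis by (simp add: Int_commute)
      qed
      have fA: "A k \<inter> W \<in> fmeasurable m" for k
        using fmeasurable_Int_fmeasurable[OF fmW As, of k] by (simp add: Int_commute)
      have "norm (measure m (A k \<inter> X n)) \<le> measure m (A k \<inter> W)" for k n
      proof -
        have "measure m (A k \<inter> X n) \<le> measure m (A k \<inter> W)"
          using As Xs by (intro measure_mono_fmeasurable fA sets.Int) (auto simp: X_def)
        then show ?thesis by simp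
      qed
      then have bd: "eventually (\<lambda>(k, n). norm (measure m (A k \<inter> X n)) \<le> measure m (A k \<inter> W)) (at_top \<times>\<^sub>F sequentially)"
        by (intro always_eventually) auto
      \<comment> \<open>Tannery's theorem exchanges limit and series: the terms are bounded by the
        measures of \<open>A k \<inter> W\<close>, which are summable because the \<open>A k\<close>
        are disjoint.\<close>
      have "(\<lambda>n. \<Sum>i. measure m (A i \<inter> X n)) \<longlonglongrightarrow> (\<Sum>i. measure m (A i \<inter> (W \<inter> E)))"
        using tannerys_theorem[OF union(3) bd sums_summable[OF su[OF fmW]]] by simp
      then show ?case using sums_unique[OF su[OF fmX]] sums_unique[OF su[OF fmWE]] by simp
    next
      case Int_stable then show ?case by (auto simp: Int_stable_def)
    next
      case closed then show ?case by auto
    qed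
  qed
  then show ?thesis by (simp add: X_def Int_assoc)
qed

end

text \<open>The part of \<open>A \<inter> W\<close> met by the translate of \<open>A\<close> by
  \<open>g\<close> tends to all of \<open>A \<inter> W\<close> as \<open>g\<close> tends to 0, so it
  is nonempty for \<open>g\<close> near 0, and a common point exhibits \<open>g\<close> as a
  difference. First countability allows testing neighbourhoods along sequences.\<close>

lemma steinhaus_difference_nhd:
  fixes m :: "'g::{topological_group_add, t2_space, second_countable_topology} measure"
  assumes haar: "left_haar_measure m" and lc: "locally_compact_space (euclidean :: 'g topology)"
    and A: "A \<in> sets borel" and pos: "emeasure m A \<noteq> 0"
  shows "eventually (\<lambda>g. \<exists>a\<in>A. \<exists>b\<in>A. g = a - b) (nhds 0)"
proof -
  have sm: "sets m = sets borel" using haar by (auto simp: left_haar_measure_def)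
  obtain \<W> where \<W>: "countable \<W>" "\<Union>\<W> = UNIV" "\<And>W. W \<in> \<W> \<Longrightarrow> open W \<and> emeasure m W < \<infinity>"
    using haar_finite_open_cover[OF haar lc] by blast
  have "\<exists>W\<in>\<W>. emeasure m (A \<inter> W) \<noteq> 0"
  proof (rule ccontr)
    assume "\<not> ?thesis"
    then have "(\<Union>W\<in>\<W>. A \<inter> W) \<in> null_sets m"
      using \<W> A sm by (intro null_sets_UN') (auto simp: null_sets_def)
    moreover have "(\<Union>W\<in>\<W>. A \<inter> W) = A" using \<W>(2) by auto
    ultimately show False using pos by auto
  qed
  then obtain W where W: "open W" "emeasure m W < \<infinity>" "emeasure m (A \<inter> W) \<noteq> 0"
    using \<W>(3) by blast
  have Ws: "W \<in> sets borel" using W by auto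
  have "emeasure m (A \<inter> W) < \<infinity>"
    using emeasure_mono[of "A \<inter> W" W m] Ws sm W(2) by (auto intro: le_less_trans)
  then have p: "0 < measure m (A \<inter> W)" using W(3)
    by (simp add: measure_def enn2real_positive_iff zero_less_iff_neq_zero)
  show ?thesis
    unfolding eventually_nhds_iff_sequentially
  proof (intro allI impI)
    fix f :: "nat \<Rightarrow> 'g" assume f: "f \<longlonglongrightarrow> 0"
    have "(\<lambda>n. measure m (A \<inter> W \<inter> (\<lambda>x. - f n + x) -` A)) \<longlonglongrightarrow> measure m (A \<inter> W \<inter> A)"
      by (rule haar_borel_translate[OF haar f W(1,2) A A])
    then have "eventually (\<lambda>n. 0 < measure m (A \<inter> W \<inter> (\<lambda>x. - f n + x) -` A)) sequentially"
      using p by (intro order_tendstoD) (auto simp: Int_commute Int_left_commute)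
    then show "eventually (\<lambda>n. \<exists>a\<in>A. \<exists>b\<in>A. f n = a - b) sequentially"
    proof eventually_elim
      case (elim n)
      then have "A \<inter> W \<inter> (\<lambda>x. - f n + x) -` A \<noteq> {}" by auto
      then obtain a where "a \<in> A" "- f n + a \<in> A" by auto
      moreover have "f n = a - (- f n + a)" by (simp add: diff_conv_add_uminus minus_add add.assoc[symmetric])
      ultimately show ?case by blast
    qed
  qed
qed

section \<open>Radon--Nikodym derivatives of a nonsingular action\<close>

text \<open>
  A Doob--Dynkin lemma modulo null sets: \<open>b\<close> is the limit of step functions whose values run through
  a countable dense set.
\<close>

lemma factor_through_AE:
  fixes f :: "'w \<Rightarrow> 'a::polish_space"
  assumes f: "f \<in> borel_measurable M" and p: "p \<in> measurable M N"
    and ex: "\<And>C. C \<in> sets borel \<Longrightarrow> \<exists>D\<in>sets N. AE w in M. f w \<in> C \<longleftrightarrow> p w \<in> D"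
  obtains b where "b \<in> borel_measurable N" "AE w in M. f w = b (p w)"
proof -
  obtain Q :: "'a set" where Q: "countable Q" "\<And>X. open X \<Longrightarrow> X \<noteq> {} \<Longrightarrow> \<exists>d\<in>Q. d \<in> X"
    by (rule countable_dense_setE) blast
  define q where "q = from_nat_into Q"
  have "Q \<noteq> {}" using Q(2)[of UNIV] by auto
  have dense: "\<exists>i. dist (q i) x < e" if "e > 0" for e x
  proof -
    have "ball x e \<noteq> {}" using that by auto
    then obtain d where "d \<in> Q" "d \<in> ball x e" using Q(2)[of "ball x e"] by blast
    then show ?thesis using from_nat_into_surj[OF Q(1)] by (metis q_def mem_ball dist_commute)
  qed
  define r :: "nat \<Rightarrow> real" where "r n = (1/2)^n" for n
  have "\<forall>n i. \<exists>D. D \<in> sets N \<and> (AE w in M. f w \<in> ball (q i) (r n) \<longleftrightarrow> p w \<in> D)"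
    using ex[OF borel_open[OF open_ball]] by blast
  then obtain D where D: "\<And>n i. D n i \<in> sets N"
    and DAE: "\<And>n i. AE w in M. f w \<in> ball (q i) (r n) \<longleftrightarrow> p w \<in> D n i"
    unfolding choice_iff by blast
  note D[measurable]
  \<comment> \<open>The centre of the first ball of radius \<open>r n\<close> whose code
    \<open>D n i\<close> contains \<open>z\<close>. For \<open>z = p w\<close> it is within
    \<open>r n\<close> of \<open>f w\<close> for almost every \<open>w\<close>.\<close>
  define b0 where "b0 n z = q (LEAST i. z \<in> D n i)" for n z
  have b0[measurable]: "b0 n \<in> borel_measurable N" for n
  proof -
    have "q \<in> measurable (count_space UNIV) borel" by simp
    then show ?thesis unfolding b0_def by measurable
  qed
  \<comment> \<open>The \<open>b0 n z\<close> may diverge at exceptional \<open>z\<close>. Replacing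
    them there by the constant \<open>q 0\<close> makes the limit exist everywhere, hence
    measurable.\<close>
  define b1 where "b1 n z = (if Cauchy (\<lambda>n. b0 n z) then b0 n z else q 0)" for n z
  have b1: "b1 n \<in> borel_measurable N" for n
    unfolding b1_def by (intro measurable_If b0 borel_measurable_const sets_Collect_Cauchy)
  have "convergent (\<lambda>n. b1 n z)" for z
    by (cases "Cauchy (\<lambda>n. b0 n z)") (auto simp: b1_def Cauchy_convergent convergent_const)
  then have b1lim: "(\<lambda>n. b1 n z) \<longlonglongrightarrow> lim (\<lambda>n. b1 n z)" for z
    by (simp add: convergent_LIMSEQ_iff)
  show thesis
  proof (rule that[of "\<lambda>z. lim (\<lambda>n. b1 n z)"])
    show "(\<lambda>z. lim (\<lambda>n. b1 n z)) \<in> borel_measurable N"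
      by (rule borel_measurable_LIMSEQ_metric[OF b1 b1lim])
    have "AE w in M. \<forall>n i. f w \<in> ball (q i) (r n) \<longleftrightarrow> p w \<in> D n i"
      using DAE by (simp add: AE_all_countable)
    then show "AE w in M. f w = lim (\<lambda>n. b1 n (p w))"
    proof (rule AE_mp, intro AE_I2 impI)
      fix w assume w: "\<forall>n i. f w \<in> ball (q i) (r n) \<longleftrightarrow> p w \<in> D n i"
      have lt: "dist (b0 n (p w)) (f w) < r n" for n
      proof -
        obtain i where "dist (q i) (f w) < r n" using dense[of "r n"] by (auto simp: r_def)
        then have "p w \<in> D n i" using w by auto
        then have "p w \<in> D n (LEAST i. p w \<in> D n i)" by (rule LeastI)
        then show ?thesis using w unfolding b0_def by (metis mem_ball)
      qed
      have r0: "r \<longlonglongrightarrow> 0" unfolding r_def by (intro LIMSEQ_realpow_zero) auto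
      have "(\<lambda>n. dist (b0 n (p w)) (f w)) \<longlonglongrightarrow> 0"
        by (rule Lim_null_comparison[OF _ r0]) (use lt in \<open>auto intro!: always_eventually less_imp_le\<close>)
      then have l: "(\<lambda>n. b0 n (p w)) \<longlonglongrightarrow> f w" by (rule tendsto_dist_iff[THEN iffD2])
      then have "Cauchy (\<lambda>n. b0 n (p w))" by (rule LIMSEQ_imp_Cauchy)
      then show "f w = lim (\<lambda>n. b1 n (p w))" using l by (simp add: b1_def limI)
    qed
  qed
qed

text \<open>Extends the hypothesis of \<open>factor_through_AE\<close> from generators to the
  completed sigma-algebra. A null set is matched by the empty set, because \<open>u\<close> has law
  \<open>M\<close>. Keeping \<open>u\<close> and \<open>p\<close> on a common space
  \<open>\<Omega>\<close> allows sets on \<open>X\<close> to be compared with sets on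
  \<open>Y\<close>.\<close>

lemma complete_sigma_AE_factor:
  assumes S: "S \<in> complete_sigma M \<G>"
    and u: "u \<in> measurable \<Omega> M" and uM: "distr \<Omega> M u = M"
    and ex: "\<And>G. G \<in> \<G> \<Longrightarrow> \<exists>D\<in>sets N. AE w in \<Omega>. u w \<in> G \<longleftrightarrow> p w \<in> D"
    and p: "p \<in> measurable \<Omega> N"
  shows "\<exists>D\<in>sets N. AE w in \<Omega>. u w \<in> S \<longleftrightarrow> p w \<in> D"
proof -
  have up: "u w \<in> space M" "p w \<in> space N" if "w \<in> space \<Omega>" for w
    using measurable_space[OF u that] measurable_space[OF p that] .
  have "S \<in> sigma_sets (space M) (\<G> \<union> null_sets (completion M))"
    using S by (simp add: complete_sigma_def)
  then show ?thesis
  proof (induct rule: sigma_sets.induct)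
    case (Basic G)
    show ?case
    proof (cases "G \<in> \<G>")
      case False
      then have "AE x in completion M. x \<notin> G" using Basic by (intro AE_not_in) auto
      then have "AE x in distr \<Omega> M u. x \<notin> G" unfolding uM by (simp add: AE_completion_iff)
      then have "AE w in \<Omega>. u w \<notin> G" by (rule AE_distrD[OF u])
      then show ?thesis by (intro bexI[of _ "{}"]) auto
    qed (use ex in auto)
  next
    case Empty
    then show ?case by (intro bexI[of _ "{}"]) auto
  next
    case (Compl a)
    then obtain D where D: "D \<in> sets N" and AE: "AE w in \<Omega>. u w \<in> a \<longleftrightarrow> p w \<in> D" by blast
    have "AE w in \<Omega>. u w \<in> space M - a \<longleftrightarrow> p w \<in> space N - D"
      using AE AE_space by eventually_elim (auto simp: up)
    with D show ?case by (intro bexI[of _ "space N - D"]) auto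
  next
    case (Union a)
    then have "\<forall>i. \<exists>D. D \<in> sets N \<and> (AE w in \<Omega>. u w \<in> a i \<longleftrightarrow> p w \<in> D)" by blast
    then obtain D where D: "\<And>i. D i \<in> sets N" and AE: "\<And>i. AE w in \<Omega>. u w \<in> a i \<longleftrightarrow> p w \<in> D i"
      by metis
    have "AE w in \<Omega>. \<forall>i::nat. u w \<in> a i \<longleftrightarrow> p w \<in> D i" using AE by (simp add: AE_all_countable)
    then have "AE w in \<Omega>. u w \<in> (\<Union>i. a i) \<longleftrightarrow> p w \<in> (\<Union>i. D i)" by eventually_elim auto
    with D show ?case by (intro bexI[of _ "\<Union>i. D i"]) auto
  qed
qed

text \<open>The convex function whose integral is relative entropy: on the positive reals it is
  nonnegative and vanishes only at 1. The values at 0 and infinity are conventions; the densities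
  below avoid both points almost everywhere.\<close>

definition entropy_gap :: "ennreal \<Rightarrow> ennreal" where
  "entropy_gap t = ennreal (enn2real t - 1 - ln (enn2real t))"

lemma entropy_gap_measurable [measurable]: "entropy_gap \<in> borel_measurable borel"
  unfolding entropy_gap_def by measurable

lemma entropy_gap_eq_0_iff: "0 < t \<Longrightarrow> t < \<infinity> \<Longrightarrow> entropy_gap t = 0 \<longleftrightarrow> t = 1"
proof (cases t)
  case (real x)
  assume "0 < t"
  then have x: "0 < x" using real by simp
  have "ln x = x - 1 \<longleftrightarrow> x = 1" using ln_eq_minus_one[OF x] by auto
  then show ?thesis using real x ln_le_minus_one[OF x]
    by (auto simp: entropy_gap_def ennreal_eq_0_iff simp flip: ennreal_1)
qed simp

text \<open>The identity is arranged so that no subtraction occurs and it can be integrated in \<^typ>\<open>ennreal\<close>.\<close>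

lemma entropy_gap_divide:
  assumes "0 < r" "r < \<infinity>" "0 < s" "s < \<infinity>"
  shows "entropy_gap r + s + r / s = entropy_gap s + entropy_gap (r / s) + r + 1"
proof (cases r)
  case r: (real a)
  show ?thesis
  proof (cases s)
    case s: (real b)
    have ab: "0 < a" "0 < b" using assms r s by auto
    have d: "r / s = ennreal (a / b)" using r s ab by (simp add: divide_ennreal)
    have g: "entropy_gap (ennreal c) = ennreal (c - 1 - ln c)" "0 \<le> c - 1 - ln c" if "0 < c" for c
      using that ln_le_minus_one[OF that] by (auto simp: entropy_gap_def)
    have ab': "0 < a / b" using ab by simp
    have "entropy_gap r + s + r / s = ennreal ((a - 1 - ln a) + b + a / b)"
      using g[OF ab(1)] ab ab' unfolding d by (simp add: r s ennreal_plus)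
    also have "(a - 1 - ln a) + b + a / b = (b - 1 - ln b) + (a / b - 1 - ln (a / b)) + a + 1"
      using ab by (simp add: ln_div)
    also have "ennreal \<dots> = ennreal (b - 1 - ln b) + ennreal (a / b - 1 - ln (a / b)) + ennreal a + 1"
    proof -
      have "ennreal (x + y + a + 1) = ennreal x + ennreal y + ennreal a + 1" if "0 \<le> x" "0 \<le> y" for x y
        using that ab by (simp add: ennreal_plus)
      then show ?thesis using g(2)[OF ab(2)] g(2)[OF ab'] by blast
    qed
    also have "\<dots> = entropy_gap s + entropy_gap (r / s) + r + 1"
      unfolding d using g(1)[OF ab(2)] g(1)[OF ab'] by (simp add: r s)
    finally show ?thesis .
  qed (use assms in auto)
qed (use assms in auto)

section \<open>Densities of the translates and the entropy formula\<close>

locale nonsingular =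
  fixes act :: "'g::topological_group_add \<Rightarrow> 'x::polish_space \<Rightarrow> 'x" and \<nu> :: "'x measure"
  assumes nonsingular: "nonsingular_space act \<nu>"
begin

lemma sets_nu [measurable_cong]: "sets \<nu> = sets borel"
  using nonsingular by (simp add: nonsingular_space_def)

lemma space_nu: "space \<nu> = UNIV"
  using sets_eq_imp_space_eq[OF sets_nu] by simp

sublocale prob_space \<nu>
  using nonsingular by (simp add: nonsingular_space_def)

lemma act_0: "act 0 x = x" and act_add: "act (g + h) x = act g (act h x)"
  using nonsingular by (auto simp: nonsingular_space_def is_action_def)

lemma act_minus: "act g (act (- g) x) = x" "act (- g) (act g x) = x"
  by (simp_all add: act_add[symmetric] act_0)

lemma act_pair_measurable [measurable]: "(\<lambda>(g, x). act g x) \<in> borel_measurable (borel \<Otimes>\<^sub>M borel)"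
  using nonsingular by (simp add: nonsingular_space_def)

lemma act_measurable [measurable]: "act g \<in> borel_measurable borel"
proof -
  have "(\<lambda>x. case (g, x) of (g, x) \<Rightarrow> act g x) \<in> borel_measurable borel" by measurable
  then show ?thesis by simp
qed

definition rn :: "'g \<Rightarrow> 'x \<Rightarrow> ennreal" where
  "rn g = RN_deriv \<nu> (distr \<nu> borel (act g))"

lemma rn_measurable [measurable]: "rn g \<in> borel_measurable borel"
  using borel_measurable_RN_deriv[of \<nu> "distr \<nu> borel (act g)"]
  by (simp add: rn_def measurable_cong_sets[OF sets_nu refl])

lemma ac_translate: "absolutely_continuous \<nu> (distr \<nu> borel (act g))"
  and ac_translate': "absolutely_continuous (distr \<nu> borel (act g)) \<nu>"
  using nonsingular by (auto simp: nonsingular_space_def)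

lemma nn_integral_act:
  assumes [measurable]: "F \<in> borel_measurable borel"
  shows "(\<integral>\<^sup>+x. F (act g x) \<partial>\<nu>) = (\<integral>\<^sup>+x. rn g x * F x \<partial>\<nu>)"
proof -
  have "(\<integral>\<^sup>+x. F (act g x) \<partial>\<nu>) = integral\<^sup>N (distr \<nu> borel (act g)) F"
    by (rule nn_integral_distr[symmetric]) measurable
  also have "\<dots> = (\<integral>\<^sup>+x. rn g x * F x \<partial>\<nu>)"
    unfolding rn_def by (rule RN_deriv_nn_integral[OF ac_translate]) (auto simp: sets_nu)
  finally show ?thesis .
qed

lemma density_rn: "density \<nu> (rn g) = distr \<nu> borel (act g)"
  unfolding rn_def by (rule density_RN_deriv[OF ac_translate]) (simp add: sets_nu)

lemma rn_unique:
  assumes "f \<in> borel_measurable borel" "density \<nu> f = distr \<nu> borel (act g)"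
  shows "AE x in \<nu>. f x = rn g x"
  unfolding rn_def using assms by (intro RN_deriv_unique) auto

lemma AE_rn_finite: "AE x in \<nu>. rn g x < \<infinity>"
proof -
  interpret D: prob_space "distr \<nu> borel (act g)" by (rule prob_space_distr) measurable
  have "AE x in \<nu>. RN_deriv \<nu> (distr \<nu> borel (act g)) x \<noteq> \<infinity>"
    by (rule RN_deriv_finite) (auto simp: ac_translate sets_nu intro: D.sigma_finite_measure_axioms)
  then show ?thesis by (simp add: rn_def less_top)
qed

lemma AE_act: 
  assumes "AE x in \<nu>. P x"
  shows "AE x in \<nu>. P (act g x)"
proof -
  have "AE x in distr \<nu> borel (act g). P x"
    using absolutely_continuous_AE[OF _ ac_translate assms] by (simp add: sets_nu)
  then show ?thesis by (rule AE_distrD[rotated]) measurable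
qed

text \<open>A density is positive almost everywhere for the measure that it defines; equivalence of
  the translate with \<open>\<nu>\<close> carries this back to \<open>\<nu>\<close>.\<close>

lemma AE_rn_pos: "AE x in \<nu>. 0 < rn g x"
proof -
  have "AE x in density \<nu> (rn g). 0 < rn g x"
    by (subst AE_density) (auto simp: zero_less_iff_neq_zero)
  then have "AE x in distr \<nu> borel (act g). 0 < rn g x" unfolding density_rn .
  from absolutely_continuous_AE[OF _ ac_translate' this] show ?thesis by (simp add: sets_nu)
qed

lemma nn_integral_rn: "(\<integral>\<^sup>+x. rn g x \<partial>\<nu>) = 1"
  using nn_integral_act[of "\<lambda>_. 1" g] by (simp add: emeasure_space_1)

lemma rn_0: "AE x in \<nu>. rn 0 x = 1"
proof -
  have "density \<nu> (\<lambda>_. 1) = distr \<nu> borel (act 0)"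
  proof -
    have "distr \<nu> borel (act 0) = distr \<nu> \<nu> (\<lambda>x. x)" by (rule distr_cong) (auto simp: sets_nu act_0)
    then show ?thesis by (simp add: density_1)
  qed
  from rn_unique[OF _ this] show ?thesis by auto
qed

text \<open>The cocycle identity: the change of variables is applied first for \<open>h\<close> and
  then for \<open>g\<close>, and the second one evaluates the density of \<open>h\<close> at the
  point moved by the inverse of \<open>g\<close>.\<close>

lemma rn_add: "AE x in \<nu>. rn (g + h) x = rn h (act (- g) x) * rn g x"
proof -
  have "density \<nu> (\<lambda>x. rn h (act (- g) x) * rn g x) = distr \<nu> borel (act (g + h))"
  proof (rule measure_eqI)
    fix A assume "A \<in> sets (density \<nu> (\<lambda>x. rn h (act (- g) x) * rn g x))"
    then have A[measurable]: "A \<in> sets borel" by (simp add: sets_nu)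
    have "emeasure (distr \<nu> borel (act (g + h))) A = integral\<^sup>N (distr \<nu> borel (act (g + h))) (indicator A)"
      by simp
    also have "\<dots> = (\<integral>\<^sup>+x. indicator A (act (g + h) x) \<partial>\<nu>)"
      by (rule nn_integral_distr) measurable
    also have "\<dots> = (\<integral>\<^sup>+x. rn h x * indicator A (act g x) \<partial>\<nu>)"
      unfolding act_add by (rule nn_integral_act) measurable
    also have "\<dots> = (\<integral>\<^sup>+x. (\<lambda>x. rn h (act (- g) x) * indicator A x) (act g x) \<partial>\<nu>)"
      by (simp add: act_minus)
    also have "\<dots> = (\<integral>\<^sup>+x. rn g x * (rn h (act (- g) x) * indicator A x) \<partial>\<nu>)"
      by (rule nn_integral_act) measurable
    also have "\<dots> = emeasure (density \<nu> (\<lambda>x. rn h (act (- g) x) * rn g x)) A"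
      by (subst emeasure_density) (auto simp: sets_nu ac_simps)
    finally show "emeasure (density \<nu> (\<lambda>x. rn h (act (- g) x) * rn g x)) A =
      emeasure (distr \<nu> borel (act (g + h))) A" by simp
  qed (simp add: sets_nu)
  from rn_unique[OF _ this] show ?thesis by auto
qed

text \<open>The relative entropy of \<open>\<nu>\<close> with respect to its translate. Since
  \<open>rn g\<close> has integral 1, the terms \<open>t - 1\<close> cancel in the mean and what
  remains is minus the integral of the logarithm, now as an integral of a nonnegative
  function.\<close>

definition gap :: "'g \<Rightarrow> ennreal" where
  "gap g = (\<integral>\<^sup>+x. entropy_gap (rn g x) \<partial>\<nu>)"

text \<open>Let \<open>P\<close> and \<open>N\<close> be the integrals of the positive and negative
  parts of the logarithm. The pointwise identity \<open>pw\<close> integrates to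
  \<open>N = gap g + P\<close> without any subtraction. As \<open>ln a\<close> is at most
  \<open>a\<close>, \<open>P\<close> is at most 1, so it can be cancelled even when the gap is
  infinite.\<close>

lemma ext_integral_ln_rn: "ext_integral \<nu> (\<lambda>x. ereal (ln (enn2real (rn g x)))) = - enn2ereal (gap g)"
proof -
  let ?l = "\<lambda>x. ln (enn2real (rn g x))"
  have pw: "entropy_gap (rn g x) + ennreal (?l x) + 1 = rn g x + ennreal (- ?l x)"
    and le: "ennreal (?l x) \<le> rn g x" if pos: "0 < rn g x" and fin: "rn g x < \<infinity>" for x
  proof -
    obtain a where "rn g x = ennreal a" "0 \<le> a"
      using fin by (cases "rn g x") auto
    then have a: "rn g x = ennreal a" "0 < a" using pos by auto
    have l: "ln a \<le> a - 1" using a by (intro ln_le_minus_one)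
    show "ennreal (?l x) \<le> rn g x" using a l by (simp add: ennreal_leI)
    show "entropy_gap (rn g x) + ennreal (?l x) + 1 = rn g x + ennreal (- ?l x)"
    proof (cases "0 \<le> ln a")
      case True
      have "ennreal (y + z + 1) = ennreal y + ennreal z + 1" if "0 \<le> y" "0 \<le> z" for y z
        using that by simp
      from this[of "a - 1 - ln a" "ln a"] True l
      have "ennreal (a - 1 - ln a) + ennreal (ln a) + 1 = ennreal a" by simp
      then show ?thesis using a True by (simp add: entropy_gap_def ennreal_neg del: ln_ge_zero_iff)
    next
      case False
      have "ennreal (y + 1) = ennreal y + 1" if "0 \<le> y" for y
        using that by simp
      from this[of "a - 1 - ln a"] l
      have "entropy_gap (rn g x) + ennreal (?l x) + 1 = ennreal (a + - ln a)"
        using a False by (simp add: entropy_gap_def ennreal_neg)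
      also have "\<dots> = rn g x + ennreal (- ?l x)"
        using a False by (subst ennreal_plus) auto
      finally show ?thesis .
    qed
  qed
  define P where "P = (\<integral>\<^sup>+x. ennreal (?l x) \<partial>\<nu>)"
  define N where "N = (\<integral>\<^sup>+x. ennreal (- ?l x) \<partial>\<nu>)"
  have AE: "AE x in \<nu>. 0 < rn g x \<and> rn g x < \<infinity>" using AE_rn_pos AE_rn_finite by auto
  have "P \<le> (\<integral>\<^sup>+x. rn g x \<partial>\<nu>)"
    unfolding P_def by (intro nn_integral_mono_AE eventually_mono[OF AE]) (simp add: le)
  then have P: "P \<le> 1" by (simp add: nn_integral_rn)
  have "(\<integral>\<^sup>+x. entropy_gap (rn g x) + ennreal (?l x) + 1 \<partial>\<nu>) = (\<integral>\<^sup>+x. rn g x + ennreal (- ?l x) \<partial>\<nu>)"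
    by (intro nn_integral_cong_AE eventually_mono[OF AE]) (simp add: pw)
  then have "gap g + P + 1 = 1 + N"
    by (simp add: nn_integral_add gap_def P_def N_def nn_integral_rn emeasure_space_1)
  then have "1 + (gap g + P) = 1 + N" by (simp add: ac_simps)
  then have N: "N = gap g + P" unfolding ennreal_add_left_cancel by simp
  have Pf: "P < \<infinity>" using P by (auto intro: le_less_trans)
  have "enn2ereal P - enn2ereal (gap g + P) = - enn2ereal (gap g)"
  proof (cases "gap g")
    case (real a)
    then show ?thesis using Pf by (cases P) (auto simp: ennreal_plus[symmetric] simp del: ennreal_plus)
  next
    case top
    then show ?thesis using Pf by (cases P) auto
  qed
  then show ?thesis
    unfolding ext_integral_def uminus_ereal.simps e2ennreal_ereal P_def[symmetric] N_def[symmetric]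
    by (simp add: N)
qed

text \<open>The outer integrand is nowhere positive, so only its negative part survives. The
  argument \<open>- g\<close> comes from the translate by the inverse in the definition of the
  entropy.\<close>

lemma furstenberg_entropy_eq:
  "furstenberg_entropy \<mu> act \<nu> = enn2ereal (\<integral>\<^sup>+g. gap (- g) \<partial>\<mu>)"
proof -
  have "furstenberg_entropy \<mu> act \<nu> = - ext_integral \<mu> (\<lambda>g. - enn2ereal (gap (- g)))"
    unfolding furstenberg_entropy_def rn_def[symmetric] ext_integral_ln_rn ..
  also have "\<dots> = enn2ereal (\<integral>\<^sup>+g. gap (- g) \<partial>\<mu>)"
    by (simp add: ext_integral_def e2ennreal_neg zero_ennreal.rep_eq)
  finally show ?thesis .
qed

text \<open>
  The densities are chosen separately for each \<open>g\<close>. A jointly measurable version comes from a single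
  Radon--Nikodym derivative on the product space; countably many test sets identify it.
\<close>

lemma rn_jointly_measurable:
  assumes sl: "sets \<rho> = sets borel" and pl: "prob_space \<rho>"
  obtains f where "f \<in> borel_measurable (borel \<Otimes>\<^sub>M borel)" "AE g in \<rho>. AE x in \<nu>. f (g, x) = rn g x"
proof -
  interpret L: prob_space \<rho> by fact
  interpret P: pair_prob_space \<rho> \<nu> ..
  note sl[measurable_cong]
  let ?B = "borel \<Otimes>\<^sub>M borel :: ('g \<times> 'x) measure"
  let ?T = "\<lambda>(g, x). (g, act g x)"
  \<comment> \<open>The skew map sends the copy of \<open>\<nu>\<close> over \<open>g\<close> to its
    translate by \<open>g\<close>, so the fibres of a density of \<open>\<theta>\<close> are
    candidates for the functions \<open>rn g\<close>.\<close>
  define \<theta> where "\<theta> = distr (\<rho> \<Otimes>\<^sub>M \<nu>) ?B ?T"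
  have T: "?T \<in> measurable (\<rho> \<Otimes>\<^sub>M \<nu>) ?B" by measurable
  have sM: "sets (\<rho> \<Otimes>\<^sub>M \<nu>) = sets ?B" by (intro sets_pair_measure_cong sl sets_nu)
  have s\<theta>: "sets \<theta> = sets (\<rho> \<Otimes>\<^sub>M \<nu>)" by (simp add: \<theta>_def sM)
  have "absolutely_continuous (\<rho> \<Otimes>\<^sub>M \<nu>) \<theta>"
    unfolding absolutely_continuous_def
  proof
    fix N assume N: "N \<in> null_sets (\<rho> \<Otimes>\<^sub>M \<nu>)"
    then have [measurable]: "N \<in> sets ?B" using sM by auto
    have "AE g in \<rho>. AE x in \<nu>. (g, x) \<notin> N" using P.AE_pair[OF AE_not_in[OF N]] .
    then have "AE g in \<rho>. AE x in \<nu>. (g, act g x) \<notin> N" by eventually_elim (rule AE_act)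
    then have "AE z in \<rho> \<Otimes>\<^sub>M \<nu>. (fst z, act (fst z) (snd z)) \<notin> N"
      by (intro P.AE_pair_measure) (auto, measurable)
    then have "AE z in \<rho> \<Otimes>\<^sub>M \<nu>. ?T z \<notin> N" by (simp add: case_prod_beta)
    then have "AE z in \<theta>. z \<notin> N"
      unfolding \<theta>_def by (subst AE_distr_iff[OF T]) auto
    then show "N \<in> null_sets \<theta>" by (subst AE_iff_null_sets) (auto simp: s\<theta> sM)
  qed
  then have dens: "density (\<rho> \<Otimes>\<^sub>M \<nu>) (RN_deriv (\<rho> \<Otimes>\<^sub>M \<nu>) \<theta>) = \<theta>"
    by (rule P.density_RN_deriv[OF _ s\<theta>])
  define f where "f = RN_deriv (\<rho> \<Otimes>\<^sub>M \<nu>) \<theta>"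
  have f[measurable]: "f \<in> borel_measurable ?B"
    unfolding f_def using borel_measurable_RN_deriv measurable_cong_sets[OF sM refl] by blast
  obtain B :: "'x set set" where B: "countable B" "topological_basis B" using ex_countable_basis by blast
  \<comment> \<open>Finite intersections of basic open sets: countable, so that one null set of
    \<open>g\<close> serves all tests, and stable under intersection, so that two probability
    measures agreeing on them coincide.\<close>
  define \<C> where "\<C> = Inter ` {F. finite F \<and> F \<subseteq> B}"
  have cC: "countable \<C>" unfolding \<C>_def by (rule countable_image[OF countable_Collect_finite_subset[OF B(1)]])
  have bC: "C \<in> sets borel" if C: "C \<in> \<C>" for C
  proof -
    obtain F where "finite F" "F \<subseteq> B" "C = \<Inter>F" using C by (auto simp: \<C>_def)
    then have "\<forall>S\<in>F. open S" using topological_basis_open[OF B(2)] by blast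
    then have "open C" using \<open>finite F\<close> unfolding \<open>C = \<Inter>F\<close> by (intro open_Inter) blast+
    then show ?thesis by (rule borel_open)
  qed
  have stable: "Int_stable \<C>"
    unfolding Int_stable_def \<C>_def
  proof (intro ballI)
    fix a b assume "a \<in> Inter ` {F. finite F \<and> F \<subseteq> B}" "b \<in> Inter ` {F. finite F \<and> F \<subseteq> B}"
    then obtain F G where "finite F" "F \<subseteq> B" "a = \<Inter>F" "finite G" "G \<subseteq> B" "b = \<Inter>G" by auto
    then show "a \<inter> b \<in> Inter ` {F. finite F \<and> F \<subseteq> B}"
      by (intro image_eqI[of _ _ "F \<union> G"]) auto
  qed
  have U: "UNIV \<in> \<C>" unfolding \<C>_def by (intro image_eqI[of _ _ "{}"]) auto
  have gen: "sets (borel :: 'x measure) = sigma_sets UNIV \<C>"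
  proof
    have "B \<subseteq> \<C>" unfolding \<C>_def by (auto intro!: image_eqI[of _ _ "{_}"])
    then show "sets (borel :: 'x measure) \<subseteq> sigma_sets UNIV \<C>"
      unfolding borel_eq_countable_basis[OF B] by (simp add: sigma_sets_subseteq)
    show "sigma_sets UNIV \<C> \<subseteq> sets (borel :: 'x measure)"
      using bC sets.sigma_sets_subset[of \<C> "borel :: 'x measure"] by auto
  qed
  have "AE g in \<rho>. (\<integral>\<^sup>+x. f (g, x) * indicator C x \<partial>\<nu>) = (\<integral>\<^sup>+x. indicator C (act g x) \<partial>\<nu>)" if "C \<in> \<C>" for C
  proof -
    have [measurable]: "C \<in> sets borel" using bC[OF that] .
    \<comment> \<open>For fixed \<open>C\<close> both sides assign to \<open>A\<close> the mass of
      \<open>A \<times> C\<close> under \<open>\<theta>\<close>; uniqueness of densities then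
      identifies the two functions of \<open>g\<close> almost everywhere.\<close>
    have "density \<rho> (\<lambda>g. \<integral>\<^sup>+x. f (g, x) * indicator C x \<partial>\<nu>) = density \<rho> (\<lambda>g. \<integral>\<^sup>+x. indicator C (act g x) \<partial>\<nu>)"
    proof (rule measure_eqI)
      fix A assume "A \<in> sets (density \<rho> (\<lambda>g. \<integral>\<^sup>+x. f (g, x) * indicator C x \<partial>\<nu>))"
      then have [measurable]: "A \<in> sets borel" by (simp add: sl)
      have pw: "(\<integral>\<^sup>+x. f (g, x) * indicator C x \<partial>\<nu>) * indicator A g = (\<integral>\<^sup>+x. f (g, x) * indicator (A \<times> C) (g, x) \<partial>\<nu>)"
        and pw': "(\<integral>\<^sup>+x. indicator C (act g x) \<partial>\<nu>) * indicator A g = (\<integral>\<^sup>+x. indicator (A \<times> C) (g, act g x) \<partial>\<nu>)" for g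
        by (cases "g \<in> A"; simp add: indicator_times)+
      have "emeasure (density \<rho> (\<lambda>g. \<integral>\<^sup>+x. f (g, x) * indicator C x \<partial>\<nu>)) A
          = (\<integral>\<^sup>+g. (\<integral>\<^sup>+x. f (g, x) * indicator (A \<times> C) (g, x) \<partial>\<nu>) \<partial>\<rho>)"
        by (subst emeasure_density) (auto simp: sl pw intro!: nn_integral_cong)
      also have "\<dots> = integral\<^sup>N (\<rho> \<Otimes>\<^sub>M \<nu>) (\<lambda>z. f z * indicator (A \<times> C) z)"
        by (rule nn_integral_fst) measurable
      also have "\<dots> = emeasure (density (\<rho> \<Otimes>\<^sub>M \<nu>) f) (A \<times> C)"
        by (subst emeasure_density) (auto simp: sM)
      also have "\<dots> = emeasure \<theta> (A \<times> C)" by (simp only: f_def dens)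
      also have "\<dots> = integral\<^sup>N \<theta> (indicator (A \<times> C))" by (simp add: s\<theta> sM)
      also have "\<dots> = integral\<^sup>N (\<rho> \<Otimes>\<^sub>M \<nu>) (\<lambda>z. indicator (A \<times> C) (?T z))"
        unfolding \<theta>_def by (rule nn_integral_distr[OF T]) measurable
      also have "\<dots> = (\<integral>\<^sup>+g. (\<integral>\<^sup>+x. indicator (A \<times> C) (?T (g, x)) \<partial>\<nu>) \<partial>\<rho>)"
        by (rule nn_integral_fst[symmetric]) measurable
      also have "\<dots> = emeasure (density \<rho> (\<lambda>g. \<integral>\<^sup>+x. indicator C (act g x) \<partial>\<nu>)) A"
        by (subst emeasure_density) (auto simp: sl pw' intro!: nn_integral_cong)
      finally show "emeasure (density \<rho> (\<lambda>g. \<integral>\<^sup>+x. f (g, x) * indicator C x \<partial>\<nu>)) A =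
          emeasure (density \<rho> (\<lambda>g. \<integral>\<^sup>+x. indicator C (act g x) \<partial>\<nu>)) A" .
    qed simp
    then show ?thesis by (subst (asm) L.density_unique_iff) auto
  qed
  then have "AE g in \<rho>. \<forall>C\<in>\<C>. (\<integral>\<^sup>+x. f (g, x) * indicator C x \<partial>\<nu>) = (\<integral>\<^sup>+x. indicator C (act g x) \<partial>\<nu>)"
    using cC by (simp add: AE_ball_countable)
  then have "AE g in \<rho>. AE x in \<nu>. f (g, x) = rn g x"
  proof eventually_elim
    fix g assume g: "\<forall>C\<in>\<C>. (\<integral>\<^sup>+x. f (g, x) * indicator C x \<partial>\<nu>) = (\<integral>\<^sup>+x. indicator C (act g x) \<partial>\<nu>)"
    have eq: "emeasure (density \<nu> (\<lambda>x. f (g, x))) C = emeasure (distr \<nu> borel (act g)) C" if "C \<in> \<C>" for C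
    proof -
      have [measurable]: "C \<in> sets borel" using bC[OF that] .
      have "emeasure (distr \<nu> borel (act g)) C = integral\<^sup>N (distr \<nu> borel (act g)) (indicator C)" by simp
      also have "\<dots> = (\<integral>\<^sup>+x. indicator C (act g x) \<partial>\<nu>)" by (rule nn_integral_distr) measurable
      also have "\<dots> = (\<integral>\<^sup>+x. f (g, x) * indicator C x \<partial>\<nu>)" using g that by simp
      finally show ?thesis by (subst emeasure_density) (auto simp: sets_nu)
    qed
    interpret D: prob_space "distr \<nu> borel (act g)" by (rule prob_space_distr) measurable
    have "density \<nu> (\<lambda>x. f (g, x)) = distr \<nu> borel (act g)"
      by (rule measure_eqI_generator_eq[OF stable, where \<Omega>=UNIV and A="\<lambda>_. UNIV"])
        (use eq U in \<open>auto simp: sets_nu gen\<close>)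
    from rn_unique[OF _ this] show "AE x in \<nu>. f (g, x) = rn g x" by measurable
  qed
  with f show thesis by (rule that)
qed

text \<open>Additivity of the integral over the group needs measurable integrands. The version
  obtained here depends on the law \<open>\<rho>\<close> under which \<open>g\<close> is
  averaged.\<close>

lemma gap_AE_measurable:
  assumes "sets \<rho> = sets borel" "prob_space \<rho>"
  obtains d where "d \<in> borel_measurable borel" "AE g in \<rho>. gap g = d g"
proof -
  obtain f where [measurable]: "f \<in> borel_measurable (borel \<Otimes>\<^sub>M borel)" and f: "AE g in \<rho>. AE x in \<nu>. f (g, x) = rn g x"
    using rn_jointly_measurable[OF assms] by blast
  show thesis
  proof (rule that[of "\<lambda>g. \<integral>\<^sup>+x. entropy_gap (f (g, x)) \<partial>\<nu>"])
    show "(\<lambda>g. \<integral>\<^sup>+x. entropy_gap (f (g, x)) \<partial>\<nu>) \<in> borel_measurable borel" by measurable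
    show "AE g in \<rho>. gap g = (\<integral>\<^sup>+x. entropy_gap (f (g, x)) \<partial>\<nu>)"
      using f 
    proof eventually_elim
      case (elim g)
      show ?case unfolding gap_def by (intro nn_integral_cong_AE eventually_mono[OF elim]) simp
    qed
  qed
qed

end

section \<open>The joint measure of a quasi-factor map\<close>

locale quasi_factor = Y: nonsingular actY \<nu>Y + X: nonsingular actX \<nu>X
  for actY :: "'g::topological_group_add \<Rightarrow> 'y::polish_space \<Rightarrow> 'y" and \<nu>Y
    and actX :: "'g \<Rightarrow> 'x::polish_space \<Rightarrow> 'x" and \<nu>X +
  fixes \<beta> :: "'y \<Rightarrow> 'x measure"
  assumes quasi_factor: "quasi_factor_map actY \<nu>Y actX \<nu>X \<beta>"
begin

lemma beta_measurable: "\<beta> \<in> borel \<rightarrow>\<^sub>M prob_algebra borel"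
  using quasi_factor by (simp add: quasi_factor_map_def measurable_cong_sets[OF Y.sets_nu refl])

lemma beta_subprob [measurable]: "\<beta> \<in> borel \<rightarrow>\<^sub>M subprob_algebra borel"
  by (rule measurable_prob_algebraD[OF beta_measurable])

lemma prob_space_beta: "prob_space (\<beta> y)"
  and sets_beta [measurable_cong]: "sets (\<beta> y) = sets borel"
  using measurable_space[OF beta_measurable, of y] by (auto simp: space_prob_algebra)

lemma beta_equivariant: "AE y in \<nu>Y. \<beta> (actY g y) = distr (\<beta> y) borel (actX g)"
  using quasi_factor by (simp add: quasi_factor_map_def equivariant_AE_def)

definition joint :: "('y \<times> 'x) measure" where
  "joint = bind \<nu>Y (\<lambda>y. distr (\<beta> y) (borel \<Otimes>\<^sub>M borel) (Pair y))"

lemma joint_kernel: "(\<lambda>y. distr (\<beta> y) (borel \<Otimes>\<^sub>M borel) (Pair y)) \<in> \<nu>Y \<rightarrow>\<^sub>M subprob_algebra (borel \<Otimes>\<^sub>M borel)"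
  by (rule measurable_distr2[where M=borel]) measurable

lemma sets_joint [measurable_cong]: "sets joint = sets (borel \<Otimes>\<^sub>M borel)"
  unfolding joint_def by (rule sets_bind) (auto simp: Y.space_nu)

lemma nn_integral_joint:
  assumes [measurable]: "F \<in> borel_measurable (borel \<Otimes>\<^sub>M borel)"
  shows "integral\<^sup>N joint F = (\<integral>\<^sup>+y. (\<integral>\<^sup>+x. F (y, x) \<partial>\<beta> y) \<partial>\<nu>Y)"
proof -
  have "integral\<^sup>N joint F = (\<integral>\<^sup>+y. integral\<^sup>N (distr (\<beta> y) (borel \<Otimes>\<^sub>M borel) (Pair y)) F \<partial>\<nu>Y)"
    unfolding joint_def by (rule nn_integral_bind[OF assms joint_kernel])
  also have "\<dots> = (\<integral>\<^sup>+y. (\<integral>\<^sup>+x. F (y, x) \<partial>\<beta> y) \<partial>\<nu>Y)"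
    by (intro nn_integral_cong nn_integral_distr) measurable
  finally show ?thesis .
qed

text \<open>Fubini for the kernel \<open>\<beta>\<close>. As \<open>P\<close> need not be
  measurable, its failures are first enclosed in a measurable null set.\<close>

lemma AE_jointD:
  assumes "AE w in joint. P w"
  shows "AE y in \<nu>Y. AE x in \<beta> y. P (y, x)"
proof -
  obtain N where N: "N \<in> null_sets joint" and sub: "{w \<in> space joint. \<not> P w} \<subseteq> N"
    using assms by (auto simp: eventually_ae_filter)
  have [measurable]: "N \<in> sets (borel \<Otimes>\<^sub>M borel)" using N sets_joint by auto
  have sp: "space joint = UNIV" using sets_eq_imp_space_eq[OF sets_joint] by (simp add: space_pair_measure)
  have "AE w in joint. w \<notin> N" using N by (rule AE_not_in)
  then have "AE y in \<nu>Y. AE w in distr (\<beta> y) (borel \<Otimes>\<^sub>M borel) (Pair y). w \<notin> N"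
    unfolding joint_def by (subst (asm) AE_bind[OF joint_kernel]) measurable
  then show ?thesis
  proof eventually_elim
    fix y assume "AE w in distr (\<beta> y) (borel \<Otimes>\<^sub>M borel) (Pair y). w \<notin> N"
    then have "AE x in \<beta> y. (y, x) \<notin> N" by (rule AE_distrD[rotated]) measurable
    then show "AE x in \<beta> y. P (y, x)" by eventually_elim (use sub sp in auto)
  qed
qed

lemma distr_joint_fst: "distr joint borel fst = \<nu>Y"
proof (rule measure_eqI)
  fix A assume "A \<in> sets (distr joint borel fst)"
  then have [measurable]: "A \<in> sets borel" by simp
  have "emeasure (distr joint borel fst) A = integral\<^sup>N (distr joint borel fst) (indicator A)" by simp
  also have "\<dots> = (\<integral>\<^sup>+w. indicator A (fst w) \<partial>joint)" by (rule nn_integral_distr) measurable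
  also have "\<dots> = (\<integral>\<^sup>+y. (\<integral>\<^sup>+x. indicator A y \<partial>\<beta> y) \<partial>\<nu>Y)" by (subst nn_integral_joint) auto
  also have "\<dots> = (\<integral>\<^sup>+y. indicator A y \<partial>\<nu>Y)"
    by (simp add: prob_space.emeasure_space_1[OF prob_space_beta])
  finally show "emeasure (distr joint borel fst) A = emeasure \<nu>Y A" by (simp add: Y.sets_nu)
qed (simp add: Y.sets_nu)

lemma distr_joint_snd: "distr joint borel snd = \<nu>X"
proof (rule measure_eqI)
  fix A assume "A \<in> sets (distr joint borel snd)"
  then have [measurable]: "A \<in> sets borel" by simp
  have \<nu>X: "\<nu>X = bind \<nu>Y \<beta>" using quasi_factor by (simp add: quasi_factor_map_def)
  have "emeasure (distr joint borel snd) A = integral\<^sup>N (distr joint borel snd) (indicator A)" by simp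
  also have "\<dots> = (\<integral>\<^sup>+w. indicator A (snd w) \<partial>joint)" by (rule nn_integral_distr) measurable
  also have "\<dots> = (\<integral>\<^sup>+y. (\<integral>\<^sup>+x. indicator A x \<partial>\<beta> y) \<partial>\<nu>Y)" by (subst nn_integral_joint) auto
  also have "\<dots> = integral\<^sup>N \<nu>X (indicator A)"
    unfolding \<nu>X by (rule nn_integral_bind[symmetric, where B=borel]) measurable
  finally show "emeasure (distr joint borel snd) A = emeasure \<nu>X A" by (simp add: X.sets_nu)
qed (simp add: X.sets_nu)

lemma prob_space_joint: "prob_space joint"
proof -
  have "fst \<in> joint \<rightarrow>\<^sub>M borel" by measurable
  then show ?thesis
    by (rule prob_space_distrD) (subst distr_joint_fst, rule Y.prob_space_axioms)
qed

sublocale joint: prob_space joint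
  by (rule prob_space_joint)

lemma AE_joint_fst: "AE y in \<nu>Y. P y \<Longrightarrow> AE w in joint. P (fst w)"
  by (rule AE_distrD[of fst joint borel P], measurable, subst distr_joint_fst)

lemma AE_joint_snd: "AE x in \<nu>X. P x \<Longrightarrow> AE w in joint. P (snd w)"
  by (rule AE_distrD[of snd joint borel P], measurable, subst distr_joint_snd)

lemma nn_integral_joint_fst:
  "F \<in> borel_measurable borel \<Longrightarrow> (\<integral>\<^sup>+w. F (fst w) \<partial>joint) = integral\<^sup>N \<nu>Y F"
  using nn_integral_distr[of fst joint borel F] by (simp add: distr_joint_fst)

lemma nn_integral_joint_snd:
  "F \<in> borel_measurable borel \<Longrightarrow> (\<integral>\<^sup>+w. F (snd w) \<partial>joint) = integral\<^sup>N \<nu>X F"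
  using nn_integral_distr[of snd joint borel F] by (simp add: distr_joint_snd)

text \<open>Equivariance of \<open>\<beta>\<close> makes the density of the translated joint measure depend on \<open>y\<close> only.\<close>

lemma nn_integral_joint_act:
  assumes [measurable]: "F \<in> borel_measurable (borel \<Otimes>\<^sub>M borel)"
  shows "(\<integral>\<^sup>+w. F (actY g (fst w), actX g (snd w)) \<partial>joint) = (\<integral>\<^sup>+w. Y.rn g (fst w) * F w \<partial>joint)"
proof -
  have [measurable]: "(\<lambda>y. \<integral>\<^sup>+x. F (y, x) \<partial>\<beta> y) \<in> borel_measurable borel"
    by (rule nn_integral_measurable_subprob_algebra2[where N=borel]) measurable
  have "(\<integral>\<^sup>+w. F (actY g (fst w), actX g (snd w)) \<partial>joint)
      = (\<integral>\<^sup>+y. (\<integral>\<^sup>+x. F (actY g y, actX g x) \<partial>\<beta> y) \<partial>\<nu>Y)"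
    by (subst nn_integral_joint) auto
  also have "\<dots> = (\<integral>\<^sup>+y. (\<integral>\<^sup>+x. F (actY g y, x) \<partial>distr (\<beta> y) borel (actX g)) \<partial>\<nu>Y)"
    by (intro nn_integral_cong nn_integral_distr[symmetric]) measurable
  also have "\<dots> = (\<integral>\<^sup>+y. (\<lambda>y. \<integral>\<^sup>+x. F (y, x) \<partial>\<beta> y) (actY g y) \<partial>\<nu>Y)"
    by (intro nn_integral_cong_AE eventually_mono[OF beta_equivariant[of g]]) simp
  also have "\<dots> = (\<integral>\<^sup>+y. Y.rn g y * (\<integral>\<^sup>+x. F (y, x) \<partial>\<beta> y) \<partial>\<nu>Y)"
    by (rule Y.nn_integral_act) measurable
  also have "\<dots> = (\<integral>\<^sup>+y. (\<integral>\<^sup>+x. Y.rn g y * F (y, x) \<partial>\<beta> y) \<partial>\<nu>Y)"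
    by (intro nn_integral_cong nn_integral_cmult[symmetric]) measurable
  also have "\<dots> = (\<integral>\<^sup>+w. Y.rn g (fst w) * F w \<partial>joint)"
    by (subst nn_integral_joint) auto
  finally show ?thesis .
qed

text \<open>The diagonal action respects null sets of \<open>joint\<close>, because the translated
  measure has a density. This allows an almost sure relation between the two coordinates to be moved
  by \<open>g\<close>.\<close>

lemma AE_joint_act:
  assumes "AE w in joint. P w"
  shows "AE w in joint. P (actY g (fst w), actX g (snd w))"
proof -
  obtain N where N: "N \<in> null_sets joint" and sub: "{w \<in> space joint. \<not> P w} \<subseteq> N"
    using assms by (auto simp: eventually_ae_filter)
  have [measurable]: "N \<in> sets (borel \<Otimes>\<^sub>M borel)" using N sets_joint by auto
  have sp: "space joint = UNIV" using sets_eq_imp_space_eq[OF sets_joint] by (simp add: space_pair_measure)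
  have "(\<integral>\<^sup>+w. indicator N (actY g (fst w), actX g (snd w)) \<partial>joint) = (\<integral>\<^sup>+w. Y.rn g (fst w) * indicator N w \<partial>joint)"
    by (rule nn_integral_joint_act) measurable
  also have "\<dots> = (\<integral>\<^sup>+w. 0 \<partial>joint)"
    by (intro nn_integral_cong_AE eventually_mono[OF AE_not_in[OF N]]) simp
  finally have "(\<integral>\<^sup>+w. indicator N (actY g (fst w), actX g (snd w)) \<partial>joint) = 0" by simp
  moreover have "(\<lambda>w. indicator N (actY g (fst w), actX g (snd w)) :: ennreal) \<in> borel_measurable joint"
    by measurable
  ultimately have "AE w in joint. indicator N (actY g (fst w), actX g (snd w)) = (0 :: ennreal)"
    by (simp only: nn_integral_0_iff_AE)
  then show ?thesis by eventually_elim (use sub sp in \<open>auto split: split_indicator_asm\<close>)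
qed

text \<open>This says that \<open>X.rn g\<close> is the conditional expectation of
  \<open>Y.rn g\<close> given the second coordinate: both sides equal the integral of
  \<open>F\<close> against the translate of \<open>\<nu>X\<close>.\<close>

lemma nn_integral_joint_rn:
  assumes [measurable]: "F \<in> borel_measurable borel"
  shows "(\<integral>\<^sup>+w. Y.rn g (fst w) * F (snd w) \<partial>joint) = (\<integral>\<^sup>+w. X.rn g (snd w) * F (snd w) \<partial>joint)"
proof -
  have "(\<integral>\<^sup>+w. Y.rn g (fst w) * F (snd w) \<partial>joint) = (\<integral>\<^sup>+w. F (actX g (snd w)) \<partial>joint)"
    using nn_integral_joint_act[of "\<lambda>w. F (snd w)" g] by simp
  also have "\<dots> = (\<integral>\<^sup>+x. F (actX g x) \<partial>\<nu>X)" by (rule nn_integral_joint_snd) measurable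
  also have "\<dots> = (\<integral>\<^sup>+x. X.rn g x * F x \<partial>\<nu>X)" by (rule X.nn_integral_act) measurable
  also have "\<dots> = (\<integral>\<^sup>+w. X.rn g (snd w) * F (snd w) \<partial>joint)"
    by (rule nn_integral_joint_snd[symmetric]) measurable
  finally show ?thesis .
qed

text \<open>The exact loss in the conditional Jensen inequality for \<open>entropy_gap\<close>.
  Having the loss as an integral of a nonnegative function makes the equality case readable.\<close>

definition defect :: "'g \<Rightarrow> ennreal" where
  "defect g = (\<integral>\<^sup>+w. entropy_gap (Y.rn g (fst w) / X.rn g (snd w)) \<partial>joint)"

lemma AE_rn_bounds:
  "AE w in joint. 0 < Y.rn g (fst w) \<and> Y.rn g (fst w) < \<infinity> \<and> 0 < X.rn g (snd w) \<and> X.rn g (snd w) < \<infinity>"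
  using AE_joint_fst[OF Y.AE_rn_pos[of g]] AE_joint_fst[OF Y.AE_rn_finite[of g]]
    AE_joint_snd[OF X.AE_rn_pos[of g]] AE_joint_snd[OF X.AE_rn_finite[of g]]
  by eventually_elim simp

text \<open>The conditional expectation identity, tested against the reciprocal of
  \<open>X.rn g\<close>.\<close>

lemma nn_integral_ratio: "(\<integral>\<^sup>+w. Y.rn g (fst w) / X.rn g (snd w) \<partial>joint) = 1"
proof -
  have "(\<integral>\<^sup>+w. Y.rn g (fst w) / X.rn g (snd w) \<partial>joint) = (\<integral>\<^sup>+w. X.rn g (snd w) * inverse (X.rn g (snd w)) \<partial>joint)"
    unfolding divide_ennreal_def by (rule nn_integral_joint_rn) measurable
  also have "\<dots> = (\<integral>\<^sup>+w. 1 \<partial>joint)"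
    by (intro nn_integral_cong_AE eventually_mono[OF AE_rn_bounds[of g]])
      (auto simp: divide_ennreal_def[symmetric] ennreal_divide_self)
  finally show ?thesis by (simp add: joint.emeasure_space_1)
qed

text \<open>Integrate \<open>entropy_gap_divide\<close> over \<open>joint\<close>. The two densities
  and their ratio all have integral 1, so the extra terms are finite, equal on both sides, and
  cancel.\<close>

lemma gap_eq: "Y.gap g = X.gap g + defect g"
proof -
  let ?r = "\<lambda>w. Y.rn g (fst w)" and ?s = "\<lambda>w. X.rn g (snd w)"
  have "(\<integral>\<^sup>+w. entropy_gap (?r w) + ?s w + ?r w / ?s w \<partial>joint)
      = (\<integral>\<^sup>+w. entropy_gap (?s w) + entropy_gap (?r w / ?s w) + ?r w + 1 \<partial>joint)"
    by (intro nn_integral_cong_AE eventually_mono[OF AE_rn_bounds[of g]] entropy_gap_divide) auto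
  moreover have "(\<integral>\<^sup>+w. ?r w \<partial>joint) = 1" "(\<integral>\<^sup>+w. ?s w \<partial>joint) = 1"
    by (simp_all add: nn_integral_joint_fst nn_integral_joint_snd Y.nn_integral_rn X.nn_integral_rn)
  moreover have "(\<integral>\<^sup>+w. entropy_gap (?r w) \<partial>joint) = Y.gap g" "(\<integral>\<^sup>+w. entropy_gap (?s w) \<partial>joint) = X.gap g"
    unfolding Y.gap_def X.gap_def by (rule nn_integral_joint_fst nn_integral_joint_snd; measurable)+
  ultimately have "Y.gap g + 1 + 1 = X.gap g + defect g + 1 + 1"
    by (simp add: nn_integral_add nn_integral_ratio joint.emeasure_space_1 defect_def[symmetric])
  then have "2 + Y.gap g = 2 + (X.gap g + defect g)" by (simp add: ac_simps)
  then show ?thesis unfolding ennreal_add_left_cancel by simp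
qed

lemma furstenberg_entropy_le: "furstenberg_entropy \<mu> actX \<nu>X \<le> furstenberg_entropy \<mu> actY \<nu>Y"
  unfolding X.furstenberg_entropy_eq Y.furstenberg_entropy_eq gap_eq
  by (subst less_eq_ennreal.rep_eq[symmetric]) (intro nn_integral_mono, simp)

lemma defect_eq_0_iff: "defect g = 0 \<longleftrightarrow> (AE w in joint. Y.rn g (fst w) = X.rn g (snd w))"
proof -
  have "defect g = 0 \<longleftrightarrow> (AE w in joint. entropy_gap (Y.rn g (fst w) / X.rn g (snd w)) = 0)"
    unfolding defect_def by (rule nn_integral_0_iff_AE) measurable
  also have "\<dots> \<longleftrightarrow> (AE w in joint. Y.rn g (fst w) = X.rn g (snd w))"
  proof (rule eventually_subst)
    have "entropy_gap (r / s) = 0 \<longleftrightarrow> r = s" if "0 < r" "r < \<infinity>" "0 < s" "s < \<infinity>" for r s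
    proof -
      have "0 < r / s" "r / s < \<infinity>"
        using that by (auto simp: ennreal_zero_less_divide ennreal_divide_eq_top_iff less_top[symmetric])
      moreover have "r / s = 1 \<longleftrightarrow> r = s"
        using that by (cases r; cases s) (auto simp: divide_ennreal)
      ultimately show ?thesis by (simp add: entropy_gap_eq_0_iff)
    qed
    then show "AE w in joint. entropy_gap (Y.rn g (fst w) / X.rn g (snd w)) = 0 \<longleftrightarrow> Y.rn g (fst w) = X.rn g (snd w)"
      by (intro eventually_mono[OF AE_rn_bounds[of g]]) blast
  qed
  finally show ?thesis .
qed

section \<open>The zeros of the defect form a subgroup\<close>

lemma defect_0: "defect 0 = 0"
  unfolding defect_eq_0_iff using AE_joint_fst[OF Y.rn_0] AE_joint_snd[OF X.rn_0] by eventually_elim simp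

text \<open>The cocycle identity holds in both coordinates. The equality for \<open>h\<close> is
  needed at the point moved by the inverse of \<open>g\<close>, which \<open>AE_joint_act\<close>
  supplies.\<close>

lemma defect_add:
  assumes "defect g = 0" "defect h = 0"
  shows "defect (g + h) = 0"
proof -
  have g: "AE w in joint. Y.rn g (fst w) = X.rn g (snd w)" and h: "AE w in joint. Y.rn h (fst w) = X.rn h (snd w)"
    using assms by (simp_all add: defect_eq_0_iff)
  show ?thesis unfolding defect_eq_0_iff
    using g AE_joint_act[OF h, of "- g"] AE_joint_fst[OF Y.rn_add[of g h]] AE_joint_snd[OF X.rn_add[of g h]]
    by eventually_elim simp
qed

text \<open>By the cocycle identity for \<open>g\<close> and \<open>- g\<close>, the density of
  \<open>- g\<close> at the moved point is the reciprocal of the density of \<open>g\<close>.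
  Cancelling the common positive finite factor gives equality at the moved point, and acting by
  \<open>g\<close> removes the displacement.\<close>

lemma defect_minus:
  assumes "defect g = 0"
  shows "defect (- g) = 0"
proof -
  have g: "AE w in joint. Y.rn g (fst w) = X.rn g (snd w)" using assms by (simp add: defect_eq_0_iff)
  have Y: "AE w in joint. 1 = Y.rn (- g) (actY (- g) (fst w)) * Y.rn g (fst w)"
    using AE_joint_fst[OF Y.rn_0] AE_joint_fst[OF Y.rn_add[of g "- g"]] by eventually_elim simp
  have X: "AE w in joint. 1 = X.rn (- g) (actX (- g) (snd w)) * X.rn g (snd w)"
    using AE_joint_snd[OF X.rn_0] AE_joint_snd[OF X.rn_add[of g "- g"]] by eventually_elim simp
  have "AE w in joint. Y.rn (- g) (actY (- g) (fst w)) = X.rn (- g) (actX (- g) (snd w))"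
    using g X Y AE_rn_bounds[of g]
  proof eventually_elim
    case (elim w)
    then have "Y.rn (- g) (actY (- g) (fst w)) * Y.rn g (fst w) = X.rn (- g) (actX (- g) (snd w)) * Y.rn g (fst w)"
      by simp
    then have "Y.rn g (fst w) * Y.rn (- g) (actY (- g) (fst w)) = Y.rn g (fst w) * X.rn (- g) (actX (- g) (snd w))"
      by (simp only: mult.commute)
    then show ?case using elim(4) unfolding ennreal_mult_cancel_left by auto
  qed
  from AE_joint_act[OF this, of g] show ?thesis
    unfolding defect_eq_0_iff by (simp add: X.act_minus Y.act_minus)
qed

lemma defect_AE_measurable:
  assumes "sets \<rho> = sets borel" "prob_space \<rho>"
  obtains d where "d \<in> borel_measurable borel" "AE g in \<rho>. defect g = d g"
proof -
  obtain fY where [measurable]: "fY \<in> borel_measurable (borel \<Otimes>\<^sub>M borel)" and fY: "AE g in \<rho>. AE x in \<nu>Y. fY (g, x) = Y.rn g x"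
    using Y.rn_jointly_measurable[OF assms] by blast
  obtain fX where [measurable]: "fX \<in> borel_measurable (borel \<Otimes>\<^sub>M borel)" and fX: "AE g in \<rho>. AE x in \<nu>X. fX (g, x) = X.rn g x"
    using X.rn_jointly_measurable[OF assms] by blast
  show thesis
  proof (rule that[of "\<lambda>g. \<integral>\<^sup>+w. entropy_gap (fY (g, fst w) / fX (g, snd w)) \<partial>joint"])
    show "(\<lambda>g. \<integral>\<^sup>+w. entropy_gap (fY (g, fst w) / fX (g, snd w)) \<partial>joint) \<in> borel_measurable borel"
      by measurable
    show "AE g in \<rho>. defect g = (\<integral>\<^sup>+w. entropy_gap (fY (g, fst w) / fX (g, snd w)) \<partial>joint)"
      using fY fX
    proof eventually_elim
      case (elim g)
      have eq: "AE w in joint. fY (g, fst w) = Y.rn g (fst w) \<and> fX (g, snd w) = X.rn g (snd w)"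
        using AE_joint_fst[OF elim(1)] AE_joint_snd[OF elim(2)] by eventually_elim simp
      show ?case unfolding defect_def by (intro nn_integral_cong_AE eventually_mono[OF eq]) simp
    qed
  qed
qed

end

section \<open>Full subgroups and Radon--Nikodym factors\<close>

text \<open>
  The set \<open>{g. P g}\<close> itself need not be Borel, hence the Borel set that is allowed to depend on the
  measure \<open>\<rho>\<close>.
\<close>

lemma conv_power_AE:
  fixes \<mu> :: "'g::{topological_group_add, t2_space, second_countable_topology} measure"
  assumes s\<mu>: "sets \<mu> = sets borel" and p\<mu>: "prob_space \<mu>"
    and P0: "P 0" and Padd: "\<And>g h. P g \<Longrightarrow> P h \<Longrightarrow> P (g + h)"
    and PB: "\<And>\<rho>. sets \<rho> = sets borel \<Longrightarrow> prob_space \<rho> \<Longrightarrow> \<exists>B\<in>sets borel. AE g in \<rho>. P g \<longleftrightarrow> g \<in> B"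
    and AE: "AE g in \<mu>. P g"
  shows "sets (conv_power \<mu> k) = sets borel" "prob_space (conv_power \<mu> k)" "AE g in conv_power \<mu> k. P g"
proof -
  have "sets (conv_power \<mu> k) = sets borel \<and> prob_space (conv_power \<mu> k) \<and> (AE g in conv_power \<mu> k. P g)"
  proof (induction k)
    case 0
    have "{x \<in> space borel. x \<noteq> (0::'g)} \<in> sets borel" by (simp add: Collect_neg_eq)
    then have "AE g in return borel (0::'g). g = 0" by (subst AE_return) (auto simp: pred_def)
    then have "AE g in return borel 0. P g" by eventually_elim (simp add: P0)
    then show ?case unfolding conv_power.simps by (simp add: prob_space_return)
  next
    case (Suc k)
    let ?\<rho> = "conv_power \<mu> k"
    interpret M: prob_space \<mu> by fact
    interpret R: prob_space ?\<rho> using Suc by simp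
    interpret PP: pair_prob_space \<mu> ?\<rho> ..
    have sP: "sets (\<mu> \<Otimes>\<^sub>M ?\<rho>) = sets (borel \<Otimes>\<^sub>M borel)"
      using Suc.IH by (intro sets_pair_measure_cong s\<mu>) auto
    have T: "(\<lambda>(g, x). g + x) \<in> borel_measurable (\<mu> \<Otimes>\<^sub>M ?\<rho>)"
      unfolding measurable_cong_sets[OF sP refl] borel_prod case_prod_beta
      by (intro borel_measurable_continuous_onI continuous_intros)
    have D: "conv_power \<mu> (Suc k) = distr (\<mu> \<Otimes>\<^sub>M ?\<rho>) borel (\<lambda>(g, x). g + x)"
      by (simp add: conv_measure_def)
    have s: "sets (conv_power \<mu> (Suc k)) = sets borel" unfolding D by simp
    have p: "prob_space (conv_power \<mu> (Suc k))" unfolding D by (rule PP.prob_space_distr[OF T])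
    \<comment> \<open>\<open>B\<close> is chosen for the law of the sum: the almost sure statement
      can be pushed forward only for a measurable set, and \<open>P\<close> is recovered from
      \<open>B\<close> afterwards.\<close>
    obtain B where [measurable]: "B \<in> sets borel" and B: "AE g in conv_power \<mu> (Suc k). P g \<longleftrightarrow> g \<in> B"
      using PB[OF s p] by blast
    have 1: "AE z in \<mu> \<Otimes>\<^sub>M ?\<rho>. P (fst z + snd z) \<longleftrightarrow> fst z + snd z \<in> B"
      using AE_distrD[OF T B[unfolded D]] by (simp add: case_prod_beta)
    have "AE x in distr (\<mu> \<Otimes>\<^sub>M ?\<rho>) \<mu> fst. P x" unfolding R.distr_pair_fst by (rule AE)
    then have 2: "AE z in \<mu> \<Otimes>\<^sub>M ?\<rho>. P (fst z)" by (rule AE_distrD[OF measurable_fst])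
    have 3: "AE z in \<mu> \<Otimes>\<^sub>M ?\<rho>. P (snd z)"
    proof -
      obtain N where N: "N \<in> null_sets ?\<rho>" "{x \<in> space ?\<rho>. \<not> P x} \<subseteq> N"
        using Suc.IH by (auto simp: eventually_ae_filter)
      have "space \<mu> \<times> N \<in> null_sets (\<mu> \<Otimes>\<^sub>M ?\<rho>)"
        using N(1) by (auto simp: null_sets_def R.emeasure_pair_measure_Times)
      from AE_not_in[OF this] AE_space show ?thesis
        by eventually_elim (use N(2) in \<open>auto simp: space_pair_measure\<close>)
    qed
    have "AE z in \<mu> \<Otimes>\<^sub>M ?\<rho>. fst z + snd z \<in> B"
      using 1 2 3 by eventually_elim (auto intro: Padd)
    then have "AE g in conv_power \<mu> (Suc k). g \<in> B"
      unfolding D by (subst AE_distr_iff[OF T]) (auto simp: case_prod_beta)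
    then have "AE g in conv_power \<mu> (Suc k). P g" using B by eventually_elim simp
    with s p show ?case by blast
  qed
  then show "sets (conv_power \<mu> k) = sets borel" "prob_space (conv_power \<mu> k)" "AE g in conv_power \<mu> k. P g"
    by auto
qed

text \<open>The elements with \<open>P\<close> form a subgroup that is Borel only up to null sets.
  Outside a Borel null set of the convolution power \<open>P\<close> holds, and that complement is
  not Haar null, which is what Steinhaus requires.\<close>

lemma admissible_full_subgroup:
  fixes \<mu> :: "'g::{topological_group_add, t2_space, second_countable_topology} measure"
  assumes lc: "locally_compact_space (euclidean :: 'g topology)"
    and s\<mu>: "sets \<mu> = sets borel" and p\<mu>: "prob_space \<mu>" and adm: "admissible \<mu>"
    and P0: "P 0" and Padd: "\<And>g h. P g \<Longrightarrow> P h \<Longrightarrow> P (g + h)" and Pminus: "\<And>g. P g \<Longrightarrow> P (- g)"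
    and PB: "\<And>\<rho>. sets \<rho> = sets borel \<Longrightarrow> prob_space \<rho> \<Longrightarrow> \<exists>B\<in>sets borel. AE g in \<rho>. P g \<longleftrightarrow> g \<in> B"
    and AE: "AE g in \<mu>. P g"
  shows "P g"
proof -
  obtain k m where k: "k \<ge> 1" and m: "left_haar_measure m" and ac: "absolutely_continuous m (conv_power \<mu> k)"
    using adm by (auto simp: admissible_def)
  have sm: "sets m = sets borel" using m by (simp add: left_haar_measure_def)
  note cp = conv_power_AE[OF s\<mu> p\<mu> P0 Padd PB AE, where k=k]
  have space_borel_eq: "space M = UNIV" if "sets M = sets borel" for M :: "'g measure"
    using sets_eq_imp_space_eq[OF that] by simp
  interpret R: prob_space "conv_power \<mu> k" by (rule cp(2))
  obtain N where N: "N \<in> null_sets (conv_power \<mu> k)" "{x \<in> space (conv_power \<mu> k). \<not> P x} \<subseteq> N"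
    using cp(3) by (auto simp: eventually_ae_filter)
  have Nb: "N \<in> sets borel" using N cp(1) by auto
  have "- N \<notin> null_sets m"
  proof
    assume "- N \<in> null_sets m"
    then have "- N \<in> null_sets (conv_power \<mu> k)" using ac by (auto simp: absolutely_continuous_def)
    then have "N \<union> - N \<in> null_sets (conv_power \<mu> k)" using N(1) by (rule null_sets.Un[rotated])
    then have "emeasure (conv_power \<mu> k) (space (conv_power \<mu> k)) = 0"
      using space_borel_eq[OF cp(1)] by (auto simp: null_sets_def)
    then show False by (simp add: R.emeasure_space_1)
  qed
  then have "emeasure m (- N) \<noteq> 0" using Nb sm by (auto simp: null_sets_def)
  from steinhaus_difference_nhd[OF m lc _ this]
  have ev: "eventually (\<lambda>g. \<exists>a\<in>- N. \<exists>b\<in>- N. g = a - b) (nhds 0)" using Nb by auto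
  have PN: "P a" if "a \<in> - N" for a using that N(2) space_borel_eq[OF cp(1)] by auto
  have "eventually P (nhds 0)"
  proof (rule eventually_mono[OF ev])
    fix g assume "\<exists>a\<in>- N. \<exists>b\<in>- N. g = a - b"
    then obtain a b where "a \<in> - N" "b \<in> - N" "g = a + - b" by auto
    then show "P g" using Padd[OF PN Pminus[OF PN], of a b] by simp
  qed
  then obtain V where V: "open V" "0 \<in> V" "\<And>g. g \<in> V \<Longrightarrow> P g" by (auto simp: eventually_nhds)
  \<comment> \<open>The neighbourhood \<open>x + V\<close> of a support point has positive mass, so
    it contains some \<open>y\<close> with \<open>P y\<close>. Then \<open>x\<close> is
    \<open>y\<close> minus an element of \<open>V\<close>.\<close>
  have supp: "P x" if x: "x \<in> measure_support \<mu>" for x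
  proof -
    define U where "U = (\<lambda>y. - x + y) -` V"
    have "open U" unfolding U_def by (rule open_vimage[OF V(1)]) (intro continuous_intros)
    moreover have "x \<in> U" using V(2) by (simp add: U_def)
    ultimately have pos: "emeasure \<mu> U > 0" using x by (auto simp: measure_support_def)
    have "\<exists>y\<in>U. P y"
    proof (rule ccontr)
      assume "\<not> ?thesis"
      then have "AE y in \<mu>. y \<notin> U" using AE by (auto elim: eventually_mono)
      then have "U \<in> null_sets \<mu>" using \<open>open U\<close> s\<mu> by (subst AE_iff_null_sets) auto
      then show False using pos by auto
    qed
    then obtain y where y: "y \<in> U" "P y" by blast
    have "x = y + - (- x + y)" by (simp add: minus_add add.assoc[symmetric])
    then show ?thesis using Padd[OF y(2) Pminus[OF V(3)], of "- x + y"] y(1) by (simp add: U_def)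
  qed
  have pw: "P x" if "x \<in> set_prod_power (measure_support \<mu>) n" for n x
    using that by (induction n arbitrary: x) (auto intro: P0 Padd supp)
  have "g \<in> (\<Union>n\<in>{1..}. set_prod_power (measure_support \<mu>) n)" using adm by (simp add: admissible_def)
  then show ?thesis using pw by auto
qed

section \<open>Comparing Radon-Nikodym factors on a common space\<close>

lemma RN_factor_sigma:
  "RN_factor act \<nu> actZ \<nu>Z p \<Longrightarrow> complete_sigma \<nu> {p -` B | B. B \<in> sets borel} = RN_sigma act \<nu>"
  by (simp add: RN_factor_def)

text \<open>Modulo null sets, membership in a Radon-Nikodym set is decided by the factor. It is
  stated along any \<open>u\<close> with law \<open>\<nu>\<close>, since \<open>u\<close> will be a
  coordinate of the joint measure or the identity.\<close>

lemma RN_sigma_factor_AE: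
  fixes p :: "'x::polish_space \<Rightarrow> 'z::polish_space"
  assumes RN: "RN_factor act \<nu> actZ \<nu>Z p" and S: "S \<in> RN_sigma act \<nu>"
    and u: "u \<in> measurable \<Omega> \<nu>" and u\<nu>: "distr \<Omega> \<nu> u = \<nu>"
  shows "\<exists>D\<in>sets borel. AE w in \<Omega>. u w \<in> S \<longleftrightarrow> p (u w) \<in> D"
proof (rule complete_sigma_AE_factor[where \<G>="{p -` B | B. B \<in> sets borel}" and p="\<lambda>w. p (u w)" and N=borel, OF _ u u\<nu>])
  have [measurable]: "p \<in> borel_measurable \<nu>" using RN by (simp add: RN_factor_def factor_map_def)
  note u[measurable]
  show "S \<in> complete_sigma \<nu> {p -` B | B. B \<in> sets borel}" using S RN_factor_sigma[OF RN] by simp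
  show "(\<lambda>w. p (u w)) \<in> borel_measurable \<Omega>" by measurable
  show "\<exists>D\<in>sets borel. AE w in \<Omega>. u w \<in> G \<longleftrightarrow> p (u w) \<in> D" if "G \<in> {p -` B | B. B \<in> sets borel}" for G
    using that by auto
qed

text \<open>A set pulled back through \<open>p\<close> is generated by densities on
  \<open>X\<close>. On \<open>\<Omega>\<close> these agree with densities on \<open>Y\<close>, which
  are decided by \<open>q\<close>; hence \<open>p\<close> after \<open>u\<close> is a function of
  \<open>q\<close> after \<open>v\<close>. The roles of \<open>X\<close> and \<open>Y\<close> will
  be exchanged to get the inverse.\<close>

lemma RN_factor_transfer:
  fixes p :: "'x::polish_space \<Rightarrow> 'z::polish_space" and q :: "'y::polish_space \<Rightarrow> 'w::polish_space"
  assumes p: "RN_factor actX \<nu>X actZ \<nu>Z p" and q: "RN_factor actY \<nu>Y actW \<nu>W q"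
    and u: "u \<in> measurable \<Omega> \<nu>X" and u\<nu>: "distr \<Omega> \<nu>X u = \<nu>X"
    and v: "v \<in> measurable \<Omega> \<nu>Y" and v\<nu>: "distr \<Omega> \<nu>Y v = \<nu>Y"
    and eq: "\<And>g. AE w in \<Omega>. RN_deriv \<nu>X (distr \<nu>X borel (actX g)) (u w) = RN_deriv \<nu>Y (distr \<nu>Y borel (actY g)) (v w)"
  obtains b where "b \<in> borel_measurable borel" "AE w in \<Omega>. p (u w) = b (q (v w))"
proof -
  note u[measurable] v[measurable]
  have [measurable]: "p \<in> borel_measurable \<nu>X" "q \<in> borel_measurable \<nu>Y"
    using p q by (auto simp: RN_factor_def factor_map_def)
  show thesis
  proof (rule factor_through_AE[of "\<lambda>w. p (u w)" \<Omega> "\<lambda>w. q (v w)" borel])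
    fix C :: "'z set" assume C: "C \<in> sets borel"
    have "p -` C \<in> complete_sigma \<nu>X {p -` B | B. B \<in> sets borel}"
      unfolding complete_sigma_def using C by (intro sigma_sets.Basic) auto
    then have S: "p -` C \<in> complete_sigma \<nu>X {RN_deriv \<nu>X (distr \<nu>X borel (actX g)) -` B | g B. B \<in> sets borel}"
      unfolding RN_factor_sigma[OF p] RN_sigma_def .
    have "\<exists>D\<in>sets borel. AE w in \<Omega>. u w \<in> p -` C \<longleftrightarrow> q (v w) \<in> D"
    proof (rule complete_sigma_AE_factor[OF S u u\<nu>])
      fix G assume "G \<in> {RN_deriv \<nu>X (distr \<nu>X borel (actX g)) -` B | g B. B \<in> sets borel}"
      then obtain g B where B: "B \<in> sets borel" and G: "G = RN_deriv \<nu>X (distr \<nu>X borel (actX g)) -` B" by blast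
      have "RN_deriv \<nu>Y (distr \<nu>Y borel (actY g)) -` B \<in> RN_sigma actY \<nu>Y"
        unfolding RN_sigma_def complete_sigma_def using B by (intro sigma_sets.Basic) auto
      from RN_sigma_factor_AE[OF q this v v\<nu>] obtain D where D: "D \<in> sets borel"
        and AE: "AE w in \<Omega>. v w \<in> RN_deriv \<nu>Y (distr \<nu>Y borel (actY g)) -` B \<longleftrightarrow> q (v w) \<in> D" by blast
      have "AE w in \<Omega>. u w \<in> G \<longleftrightarrow> q (v w) \<in> D"
        using AE eq[of g] by eventually_elim (simp add: G)
      with D show "\<exists>D\<in>sets borel. AE w in \<Omega>. u w \<in> G \<longleftrightarrow> q (v w) \<in> D" by blast
    qed measurable
    then show "\<exists>D\<in>sets borel. AE w in \<Omega>. p (u w) \<in> C \<longleftrightarrow> q (v w) \<in> D" by simp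
  qed (measurable, rule that)
qed

lemma AE_distr_eq_iff:
  fixes f h :: "'a \<Rightarrow> 'b::polish_space"
  assumes [measurable]: "T \<in> measurable M N" "f \<in> borel_measurable N" "h \<in> borel_measurable N"
  shows "(AE x in distr M N T. f x = h x) \<longleftrightarrow> (AE x in M. f (T x) = h (T x))"
proof (rule AE_distr_iff)
  have "(\<lambda>x. dist (f x) (h x)) \<in> borel_measurable N" by (rule borel_measurable_dist) measurable
  then have "{x \<in> space N. dist (f x) (h x) = 0} \<in> sets N" by measurable
  then show "{x \<in> space N. f x = h x} \<in> sets N" by simp
qed measurable

text \<open>The detour through \<open>enn2real\<close> gives the Polish target that
  \<open>factor_through_AE\<close> asks for; almost sure finiteness of the density makes it
  lossless.\<close>

lemma (in nonsingular) rn_factors_through_RN_factor: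
  assumes RN: "RN_factor act \<nu> actZ \<nu>Z p"
  obtains R :: "'z::polish_space \<Rightarrow> real" where "R \<in> borel_measurable borel" "AE x in \<nu>. rn g x = ennreal (R (p x))"
proof -
  have p[measurable]: "p \<in> borel_measurable \<nu>" using RN by (simp add: RN_factor_def factor_map_def)
  have "\<exists>D\<in>sets borel. AE x in \<nu>. enn2real (rn g x) \<in> C \<longleftrightarrow> p x \<in> D" if C: "C \<in> sets borel" for C
  proof -
    have "enn2real -` C \<inter> space borel \<in> sets borel" by (rule measurable_sets[OF _ C]) measurable
    then have "rn g -` (enn2real -` C) \<in> RN_sigma act \<nu>"
      unfolding RN_sigma_def complete_sigma_def rn_def by (intro sigma_sets.Basic) auto
    from RN_sigma_factor_AE[OF RN this measurable_ident_sets[OF refl] distr_id]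
    show ?thesis by simp
  qed
  moreover have "(\<lambda>x. enn2real (rn g x)) \<in> borel_measurable \<nu>" by measurable
  ultimately obtain R where R: "R \<in> borel_measurable borel" "AE x in \<nu>. enn2real (rn g x) = R (p x)"
    using p by (elim factor_through_AE[rotated 2]) blast+
  have "AE x in \<nu>. rn g x = ennreal (R (p x))"
    using R(2) AE_rn_finite[of g] by eventually_elim (metis ennreal_enn2real infinity_ennreal_def)
  with R(1) show thesis by (rule that)
qed

section \<open>Vanishing defect and isomorphism of the factors\<close>

context quasi_factor
begin

lemma AE_jointI:
  assumes P: "{w. P w} \<in> sets (borel \<Otimes>\<^sub>M borel)"
    and AE: "AE y in \<nu>Y. AE x in \<beta> y. P (y, x)"
  shows "AE w in joint. P w"
proof -
  have Q: "Measurable.pred (borel \<Otimes>\<^sub>M borel) P" using P by (simp add: pred_def space_pair_measure)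
  have T: "Pair y \<in> \<beta> y \<rightarrow>\<^sub>M borel \<Otimes>\<^sub>M borel" for y :: 'y by measurable
  show ?thesis
    unfolding joint_def AE_bind[OF joint_kernel Q]
    using AE by eventually_elim (subst AE_distr_iff[OF T], use P in \<open>simp_all add: space_pair_measure\<close>)
qed

text \<open>A function of the second coordinate is its own conditional expectation, so
  \<open>Q\<close> is a density of the translate of \<open>\<nu>X\<close> and must be
  \<open>X.rn g\<close>.\<close>

lemma defect_eq_0_if_factors:
  assumes [measurable]: "Q \<in> borel_measurable borel"
    and AE: "AE w in joint. Y.rn g (fst w) = Q (snd w)"
  shows "defect g = 0"
proof -
  have "density \<nu>X Q = density \<nu>X (X.rn g)"
  proof (rule measure_eqI)
    fix A assume "A \<in> sets (density \<nu>X Q)"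
    then have [measurable]: "A \<in> sets borel" by (simp add: X.sets_nu)
    have "emeasure (density \<nu>X Q) A = (\<integral>\<^sup>+x. Q x * indicator A x \<partial>\<nu>X)"
      by (rule emeasure_density) measurable
    also have "\<dots> = (\<integral>\<^sup>+w. Q (snd w) * indicator A (snd w) \<partial>joint)"
      by (rule nn_integral_joint_snd[symmetric]) measurable
    also have "\<dots> = (\<integral>\<^sup>+w. Y.rn g (fst w) * indicator A (snd w) \<partial>joint)"
      by (intro nn_integral_cong_AE eventually_mono[OF AE]) simp
    also have "\<dots> = (\<integral>\<^sup>+w. X.rn g (snd w) * indicator A (snd w) \<partial>joint)"
      by (rule nn_integral_joint_rn) measurable
    also have "\<dots> = (\<integral>\<^sup>+x. X.rn g x * indicator A x \<partial>\<nu>X)"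
      by (rule nn_integral_joint_snd) measurable
    also have "\<dots> = emeasure (density \<nu>X (X.rn g)) A"
      by (rule emeasure_density[symmetric]) measurable
    finally show "emeasure (density \<nu>X Q) A = emeasure (density \<nu>X (X.rn g)) A" .
  qed simp
  then have "AE x in \<nu>X. Q x = X.rn g x" by (intro X.rn_unique) (simp_all add: X.density_rn)
  from AE_joint_snd[OF this] AE show ?thesis
    unfolding defect_eq_0_iff by eventually_elim simp
qed

text \<open>Transfer in both directions yields \<open>b\<close> and \<open>c\<close>. Their
  properties are checked on \<open>joint\<close>, where both are tied to the coordinates, and then
  pushed forward to the factors.\<close>

lemma isomorphism_if_rn_eq:
  fixes \<pi>X :: "'x \<Rightarrow> 'z::polish_space" and \<pi>Y :: "'y \<Rightarrow> 'w::polish_space"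
  assumes RX: "RN_factor actX \<nu>X actZ \<nu>Z \<pi>X" and RY: "RN_factor actY \<nu>Y actW \<nu>W \<pi>Y"
    and d: "\<And>g. defect g = 0"
  shows "\<exists>b. factor_isomorphism actW \<nu>W actZ \<nu>Z b \<and> (AE y in \<nu>Y. distr (\<beta> y) borel \<pi>X = return borel (b (\<pi>Y y)))"
proof -
  interpret Z: nonsingular actZ \<nu>Z using RX by unfold_locales (simp add: RN_factor_def)
  interpret W: nonsingular actW \<nu>W using RY by unfold_locales (simp add: RN_factor_def)
  have fX: "factor_map actX \<nu>X actZ \<nu>Z \<pi>X" and fY: "factor_map actY \<nu>Y actW \<nu>W \<pi>Y"
    using RX RY by (simp_all add: RN_factor_def)
  have [measurable]: "\<pi>X \<in> borel_measurable borel"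
    using fX by (simp add: factor_map_def measurable_cong_sets[OF X.sets_nu refl])
  have [measurable]: "\<pi>Y \<in> borel_measurable borel"
    using fY by (simp add: factor_map_def measurable_cong_sets[OF Y.sets_nu refl])
  have dX: "distr \<nu>X borel \<pi>X = \<nu>Z" and dY: "distr \<nu>Y borel \<pi>Y = \<nu>W"
    using fX fY by (simp_all add: factor_map_def)
  have eX: "AE x in \<nu>X. \<pi>X (actX g x) = actZ g (\<pi>X x)" and eY: "AE y in \<nu>Y. \<pi>Y (actY g y) = actW g (\<pi>Y y)" for g
    using fX fY by (simp_all add: factor_map_def equivariant_AE_def)
  have mf: "fst \<in> measurable joint \<nu>Y" and ms: "snd \<in> measurable joint \<nu>X" by measurable
  have df: "distr joint \<nu>Y fst = \<nu>Y" using distr_joint_fst by (simp add: Y.sets_nu cong: distr_cong)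
  have ds: "distr joint \<nu>X snd = \<nu>X" using distr_joint_snd by (simp add: X.sets_nu cong: distr_cong)
  have rn: "AE w in joint. RN_deriv \<nu>Y (distr \<nu>Y borel (actY g)) (fst w) = RN_deriv \<nu>X (distr \<nu>X borel (actX g)) (snd w)" for g
    using d[of g] unfolding defect_eq_0_iff Y.rn_def X.rn_def .
  have rn': "AE w in joint. RN_deriv \<nu>X (distr \<nu>X borel (actX g)) (snd w) = RN_deriv \<nu>Y (distr \<nu>Y borel (actY g)) (fst w)" for g
    using rn[of g] by eventually_elim simp
  obtain b where [measurable]: "b \<in> borel_measurable borel" and b: "AE w in joint. \<pi>X (snd w) = b (\<pi>Y (fst w))"
    using RN_factor_transfer[OF RX RY ms ds mf df rn'] by blast
  obtain c where [measurable]: "c \<in> borel_measurable borel" and c: "AE w in joint. \<pi>Y (fst w) = c (\<pi>X (snd w))"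
    using RN_factor_transfer[OF RY RX mf df ms ds rn] by blast
  have JX: "distr joint borel (\<lambda>w. \<pi>X (snd w)) = \<nu>Z"
  proof -
    have "distr joint borel (\<lambda>w. \<pi>X (snd w)) = distr (distr joint borel snd) borel \<pi>X"
      by (subst distr_distr) (auto simp: comp_def)
    then show ?thesis by (simp only: distr_joint_snd dX)
  qed
  have JY: "distr joint borel (\<lambda>w. \<pi>Y (fst w)) = \<nu>W"
  proof -
    have "distr joint borel (\<lambda>w. \<pi>Y (fst w)) = distr (distr joint borel fst) borel \<pi>Y"
      by (subst distr_distr) (auto simp: comp_def)
    then show ?thesis by (simp only: distr_joint_fst dY)
  qed
  have AE_Z: "AE z in \<nu>Z. f z = h z" if "AE w in joint. f (\<pi>X (snd w)) = h (\<pi>X (snd w))"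
      "f \<in> borel_measurable borel" "h \<in> borel_measurable borel" for f h :: "'z \<Rightarrow> 'c::polish_space"
    unfolding JX[symmetric] using that by (subst AE_distr_eq_iff) auto
  have AE_W: "AE z in \<nu>W. f z = h z" if "AE w in joint. f (\<pi>Y (fst w)) = h (\<pi>Y (fst w))"
      "f \<in> borel_measurable borel" "h \<in> borel_measurable borel" for f h :: "'w \<Rightarrow> 'c::polish_space"
    unfolding JY[symmetric] using that by (subst AE_distr_eq_iff) auto
  have "distr \<nu>W borel b = distr joint borel (\<lambda>w. b (\<pi>Y (fst w)))"
    unfolding JY[symmetric] by (subst distr_distr) (auto simp: comp_def)
  also have "\<dots> = \<nu>Z" 
    unfolding JX[symmetric] by (rule distr_cong_AE) (use b in \<open>auto elim: eventually_mono\<close>)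
  finally have db: "distr \<nu>W borel b = \<nu>Z" .
  have "distr \<nu>Z borel c = distr joint borel (\<lambda>w. c (\<pi>X (snd w)))"
    unfolding JX[symmetric] by (subst distr_distr) (auto simp: comp_def)
  also have "\<dots> = \<nu>W" 
    unfolding JY[symmetric] by (rule distr_cong_AE) (use c in \<open>auto elim: eventually_mono\<close>)
  finally have dc: "distr \<nu>Z borel c = \<nu>W" .
  \<comment> \<open>The relation defining \<open>b\<close> holds at a point and at its translate by
    \<open>g\<close>; equivariance of the two factor maps compares them.\<close>
  have "AE w in joint. b (actW g (\<pi>Y (fst w))) = actZ g (b (\<pi>Y (fst w)))" for g
    using AE_joint_act[OF b, of g] b AE_joint_fst[OF eY[of g]] AE_joint_snd[OF eX[of g]]
    by eventually_elim simp
  then have eb: "AE z in \<nu>W. b (actW g z) = actZ g (b z)" for g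
    by (intro AE_W) measurable
  have "AE w in joint. c (actZ g (\<pi>X (snd w))) = actW g (c (\<pi>X (snd w)))" for g
    using AE_joint_act[OF c, of g] c AE_joint_fst[OF eY[of g]] AE_joint_snd[OF eX[of g]]
    by eventually_elim simp
  then have ec: "AE z in \<nu>Z. c (actZ g z) = actW g (c z)" for g
    by (intro AE_Z) measurable
  have "AE w in joint. c (b (\<pi>Y (fst w))) = \<pi>Y (fst w)" using b c by eventually_elim simp
  then have cb: "AE z in \<nu>W. c (b z) = z" by (intro AE_W) measurable
  have "AE w in joint. b (c (\<pi>X (snd w))) = \<pi>X (snd w)" using b c by eventually_elim simp
  then have bc: "AE z in \<nu>Z. b (c z) = z" by (intro AE_Z) measurable
  have "factor_map actW \<nu>W actZ \<nu>Z b"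
    unfolding factor_map_def equivariant_AE_def by (intro conjI allI db eb) measurable
  moreover have "factor_map actZ \<nu>Z actW \<nu>W c"
    unfolding factor_map_def equivariant_AE_def by (intro conjI allI dc ec) measurable
  ultimately have iso: "factor_isomorphism actW \<nu>W actZ \<nu>Z b"
    unfolding factor_isomorphism_def using cb bc by blast
  \<comment> \<open>Disintegrated over \<open>y\<close>, the relation says that
    \<open>\<pi>X\<close> is almost surely constant under \<open>\<beta> y\<close>, so its law is a
    Dirac mass.\<close>
  have "AE y in \<nu>Y. distr (\<beta> y) borel \<pi>X = return borel (b (\<pi>Y y))"
    using AE_jointD[OF b]
  proof eventually_elim
    fix y assume *: "AE x in \<beta> y. \<pi>X (snd (y, x)) = b (\<pi>Y (fst (y, x)))"
    interpret B: prob_space "\<beta> y" by (rule prob_space_beta)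
    have "distr (\<beta> y) borel \<pi>X = distr (\<beta> y) borel (\<lambda>x. b (\<pi>Y y))"
      using * by (intro distr_cong_AE) auto
    then show "distr (\<beta> y) borel \<pi>X = return borel (b (\<pi>Y y))" by simp
  qed
  with iso show ?thesis by blast
qed

text \<open>The Dirac condition ties the two factor points together on \<open>joint\<close>. The
  inverse \<open>c\<close> then recovers the point over \<open>y\<close> from \<open>x\<close>, and
  \<open>Y.rn g\<close> depends on that point alone.\<close>

lemma defect_eq_0_if_isomorphism:
  fixes \<pi>X :: "'x \<Rightarrow> 'z::polish_space" and \<pi>Y :: "'y \<Rightarrow> 'w::polish_space"
  assumes RX: "RN_factor actX \<nu>X actZ \<nu>Z \<pi>X" and RY: "RN_factor actY \<nu>Y actW \<nu>W \<pi>Y"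
    and iso: "factor_isomorphism actW \<nu>W actZ \<nu>Z b"
    and Dirac: "AE y in \<nu>Y. distr (\<beta> y) borel \<pi>X = return borel (b (\<pi>Y y))"
  shows "defect g = 0"
proof -
  interpret Z: nonsingular actZ \<nu>Z using RX by unfold_locales (simp add: RN_factor_def)
  interpret W: nonsingular actW \<nu>W using RY by unfold_locales (simp add: RN_factor_def)
  have fX: "factor_map actX \<nu>X actZ \<nu>Z \<pi>X" and fY: "factor_map actY \<nu>Y actW \<nu>W \<pi>Y"
    using RX RY by (simp_all add: RN_factor_def)
  have [measurable]: "\<pi>X \<in> borel_measurable borel"
    using fX by (simp add: factor_map_def measurable_cong_sets[OF X.sets_nu refl])
  have piY[measurable]: "\<pi>Y \<in> borel_measurable borel"
    using fY by (simp add: factor_map_def measurable_cong_sets[OF Y.sets_nu refl])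
  have dY: "distr \<nu>Y borel \<pi>Y = \<nu>W" using fY by (simp add: factor_map_def)
  obtain c where c: "factor_map actZ \<nu>Z actW \<nu>W c" and cb: "AE z in \<nu>W. c (b z) = z"
    using iso by (auto simp: factor_isomorphism_def)
  have [measurable]: "c \<in> borel_measurable borel"
    using c by (simp add: factor_map_def measurable_cong_sets[OF Z.sets_nu refl])
  have [measurable]: "b \<in> borel_measurable borel"
    using iso by (simp add: factor_isomorphism_def factor_map_def measurable_cong_sets[OF W.sets_nu refl])
  have eq: "AE w in joint. \<pi>X (snd w) = b (\<pi>Y (fst w))"
  proof (rule AE_jointI)
    have "(\<lambda>w. dist (\<pi>X (snd w)) (b (\<pi>Y (fst w)))) \<in> borel_measurable (borel \<Otimes>\<^sub>M borel)"
      by (rule borel_measurable_dist) measurable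
    then have "{w \<in> space (borel \<Otimes>\<^sub>M borel). dist (\<pi>X (snd w)) (b (\<pi>Y (fst w))) = 0} \<in> sets (borel \<Otimes>\<^sub>M borel)"
      by measurable
    then show "{w. \<pi>X (snd w) = b (\<pi>Y (fst w))} \<in> sets (borel \<Otimes>\<^sub>M borel)"
      by (simp add: space_pair_measure)
    show "AE y in \<nu>Y. AE x in \<beta> y. \<pi>X (snd (y, x)) = b (\<pi>Y (fst (y, x)))"
      using Dirac
    proof eventually_elim
      case (elim y)
      have "AE z in return borel (b (\<pi>Y y)). z = b (\<pi>Y y)"
        by (subst AE_return) (auto simp: pred_def)
      then have "AE z in distr (\<beta> y) borel \<pi>X. z = b (\<pi>Y y)" unfolding elim .
      then have "AE x in \<beta> y. \<pi>X x = b (\<pi>Y y)" by (rule AE_distrD[rotated]) measurable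
      then show ?case by simp
    qed
  qed
  have "AE y in \<nu>Y. c (b (\<pi>Y y)) = \<pi>Y y"
  proof -
    have "\<pi>Y \<in> borel_measurable \<nu>Y" by measurable
    moreover have "AE z in distr \<nu>Y borel \<pi>Y. c (b z) = z" unfolding dY by (rule cb)
    ultimately show ?thesis by (rule AE_distrD)
  qed
  from AE_joint_fst[OF this] eq have cX: "AE w in joint. c (\<pi>X (snd w)) = \<pi>Y (fst w)"
    by eventually_elim simp
  obtain R where [measurable]: "R \<in> borel_measurable borel" and R: "AE y in \<nu>Y. Y.rn g y = ennreal (R (\<pi>Y y))"
    using Y.rn_factors_through_RN_factor[OF RY] by blast
  show ?thesis
  proof (rule defect_eq_0_if_factors)
    show "(\<lambda>x. ennreal (R (c (\<pi>X x)))) \<in> borel_measurable borel" by measurable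
    show "AE w in joint. Y.rn g (fst w) = ennreal (R (c (\<pi>X (snd w))))"
      using AE_joint_fst[OF R] cX by eventually_elim simp
  qed
qed

text \<open>Integrating \<open>gap_eq\<close> and cancelling the common finite entropy leaves an
  integral of defects equal to 0. The measurable versions are taken for the law of the inverse,
  because the entropy evaluates the gap at \<open>- g\<close>.\<close>

lemma AE_defect_eq_0:
  fixes \<mu> :: "'g measure"
  assumes s\<mu>: "sets \<mu> = sets borel" and p\<mu>: "prob_space \<mu>"
    and m: "uminus \<in> borel_measurable (borel :: 'g measure)"
    and fin: "furstenberg_entropy \<mu> actY \<nu>Y < \<infinity>"
    and eq: "furstenberg_entropy \<mu> actX \<nu>X = furstenberg_entropy \<mu> actY \<nu>Y"
  shows "AE g in \<mu>. defect (- g) = 0"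
proof -
  let ?\<rho> = "distr \<mu> borel uminus"
  have m': "uminus \<in> borel_measurable \<mu>" using m by (simp add: measurable_cong_sets[OF s\<mu> refl])
  note m'[measurable]
  have p: "prob_space ?\<rho>" by (rule prob_space.prob_space_distr[OF p\<mu> m'])
  obtain d where [measurable]: "d \<in> borel_measurable borel" and d: "AE g in ?\<rho>. defect g = d g"
    using defect_AE_measurable[of ?\<rho>] p by auto
  obtain e where [measurable]: "e \<in> borel_measurable borel" and e: "AE g in ?\<rho>. X.gap g = e g"
    using X.gap_AE_measurable[of ?\<rho>] p by auto
  have d': "AE g in \<mu>. defect (- g) = d (- g)" and e': "AE g in \<mu>. X.gap (- g) = e (- g)"
    using AE_distrD[OF m' d] AE_distrD[OF m' e] by auto
  have X: "(\<integral>\<^sup>+g. X.gap (- g) \<partial>\<mu>) = (\<integral>\<^sup>+g. e (- g) \<partial>\<mu>)"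
    by (rule nn_integral_cong_AE[OF e'])
  have ed: "AE g in \<mu>. X.gap (- g) + defect (- g) = e (- g) + d (- g)"
    using d' e' by eventually_elim simp
  have Y: "(\<integral>\<^sup>+g. Y.gap (- g) \<partial>\<mu>) = (\<integral>\<^sup>+g. e (- g) \<partial>\<mu>) + (\<integral>\<^sup>+g. d (- g) \<partial>\<mu>)"
    unfolding gap_eq nn_integral_cong_AE[OF ed] by (rule nn_integral_add) measurable
  have "(\<integral>\<^sup>+g. X.gap (- g) \<partial>\<mu>) = (\<integral>\<^sup>+g. Y.gap (- g) \<partial>\<mu>)"
    using eq unfolding X.furstenberg_entropy_eq Y.furstenberg_entropy_eq by (simp add: enn2ereal_inject)
  then have "(\<integral>\<^sup>+g. e (- g) \<partial>\<mu>) + 0 = (\<integral>\<^sup>+g. e (- g) \<partial>\<mu>) + (\<integral>\<^sup>+g. d (- g) \<partial>\<mu>)"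
    unfolding X Y by simp
  moreover have "(\<integral>\<^sup>+g. e (- g) \<partial>\<mu>) \<noteq> \<infinity>"
    using fin unfolding eq[symmetric] X.furstenberg_entropy_eq X by auto
  ultimately have "(\<integral>\<^sup>+g. d (- g) \<partial>\<mu>) = 0" unfolding ennreal_add_left_cancel by auto
  then have "AE g in \<mu>. d (- g) = 0"
    by (subst (asm) nn_integral_0_iff_AE) auto
  with d' show ?thesis by eventually_elim simp
qed

end

theorem theoremB:
  fixes \<mu> :: "'g::{topological_group_add, t2_space, second_countable_topology} measure"
    and actX :: "'g \<Rightarrow> 'x::polish_space \<Rightarrow> 'x" and \<nu>X :: "'x measure"
    and actY :: "'g \<Rightarrow> 'y::polish_space \<Rightarrow> 'y" and \<nu>Y :: "'y measure"
    and \<beta> :: "'y \<Rightarrow> 'x measure"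
  assumes "locally_compact_space (euclidean :: 'g topology)"
    and "sets \<mu> = sets borel" and "prob_space \<mu>" and "admissible \<mu>"
    and "compact_stationary_space \<mu> actX \<nu>X"
    and "compact_stationary_space \<mu> actY \<nu>Y"
    and "quasi_factor_map actY \<nu>Y actX \<nu>X \<beta>"
  shows "furstenberg_entropy \<mu> actX \<nu>X \<le> furstenberg_entropy \<mu> actY \<nu>Y \<and>
    (furstenberg_entropy \<mu> actY \<nu>Y < \<infinity> \<longrightarrow>
      (\<forall>(actXRN :: 'g \<Rightarrow> 'xrn::polish_space \<Rightarrow> 'xrn) \<nu>XRN \<pi>X
        (actYRN :: 'g \<Rightarrow> 'yrn::polish_space \<Rightarrow> 'yrn) \<nu>YRN \<pi>Y.
        RN_factor actX \<nu>X actXRN \<nu>XRN \<pi>X \<longrightarrow>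
        RN_factor actY \<nu>Y actYRN \<nu>YRN \<pi>Y \<longrightarrow>
        (furstenberg_entropy \<mu> actX \<nu>X = furstenberg_entropy \<mu> actY \<nu>Y \<longleftrightarrow>
          (\<exists>\<beta>RN. factor_isomorphism actYRN \<nu>YRN actXRN \<nu>XRN \<beta>RN \<and>
             (AE y in \<nu>Y. distr (\<beta> y) borel \<pi>X = return borel (\<beta>RN (\<pi>Y y)))))))"
proof -
  interpret quasi_factor actY \<nu>Y actX \<nu>X \<beta>
    using assms by unfold_locales (auto simp: compact_stationary_space_def stationary_space_def)
  have um: "uminus \<in> borel_measurable (borel :: 'g measure)"
    by (intro borel_measurable_continuous_onI continuous_intros)
  have defect_all: "defect g = 0"
    if fin: "furstenberg_entropy \<mu> actY \<nu>Y < \<infinity>"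
      and eq: "furstenberg_entropy \<mu> actX \<nu>X = furstenberg_entropy \<mu> actY \<nu>Y" for g
  proof (rule admissible_full_subgroup[OF assms(1-4), where P="\<lambda>g. defect g = 0"])
    show "\<exists>B\<in>sets borel. AE g in \<rho>. defect g = 0 \<longleftrightarrow> g \<in> B"
      if s: "sets \<rho> = sets borel" and p: "prob_space \<rho>" for \<rho>
    proof -
      obtain d where d: "d \<in> borel_measurable borel" and AE: "AE g in \<rho>. defect g = d g"
        using defect_AE_measurable[OF s p] by blast
      have "d -` {0} \<inter> space borel \<in> sets borel" using d by (rule measurable_sets) simp
      moreover have "AE g in \<rho>. defect g = 0 \<longleftrightarrow> g \<in> d -` {0} \<inter> space borel"
        using AE by eventually_elim simp
      ultimately show ?thesis by blast
    qed
    \<comment> \<open>The integrated statement concerns \<open>- g\<close>; closure of the zero set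
      under inverses turns it into one about \<open>g\<close>.\<close>
    show "AE g in \<mu>. defect g = 0"
      using AE_defect_eq_0[OF assms(2,3) um fin eq] by eventually_elim (use defect_minus in fastforce)
  qed (simp_all add: defect_0 defect_add defect_minus)
  show ?thesis
  proof (intro conjI impI allI iffI)
    show "furstenberg_entropy \<mu> actX \<nu>X \<le> furstenberg_entropy \<mu> actY \<nu>Y"
      by (rule furstenberg_entropy_le)
  next
    fix actXRN :: "'g \<Rightarrow> 'xrn \<Rightarrow> 'xrn" and \<nu>XRN \<pi>X and actYRN :: "'g \<Rightarrow> 'yrn \<Rightarrow> 'yrn" and \<nu>YRN \<pi>Y
    assume fin: "furstenberg_entropy \<mu> actY \<nu>Y < \<infinity>"
      and RX: "RN_factor actX \<nu>X actXRN \<nu>XRN \<pi>X" and RY: "RN_factor actY \<nu>Y actYRN \<nu>YRN \<pi>Y"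
      and eq: "furstenberg_entropy \<mu> actX \<nu>X = furstenberg_entropy \<mu> actY \<nu>Y"
    show "\<exists>\<beta>RN. factor_isomorphism actYRN \<nu>YRN actXRN \<nu>XRN \<beta>RN \<and>
       (AE y in \<nu>Y. distr (\<beta> y) borel \<pi>X = return borel (\<beta>RN (\<pi>Y y)))"
      by (rule isomorphism_if_rn_eq[OF RX RY defect_all[OF fin eq]])
  next
    fix actXRN :: "'g \<Rightarrow> 'xrn \<Rightarrow> 'xrn" and \<nu>XRN \<pi>X and actYRN :: "'g \<Rightarrow> 'yrn \<Rightarrow> 'yrn" and \<nu>YRN \<pi>Y
    assume RX: "RN_factor actX \<nu>X actXRN \<nu>XRN \<pi>X" and RY: "RN_factor actY \<nu>Y actYRN \<nu>YRN \<pi>Y"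
      and "\<exists>\<beta>RN. factor_isomorphism actYRN \<nu>YRN actXRN \<nu>XRN \<beta>RN \<and>
       (AE y in \<nu>Y. distr (\<beta> y) borel \<pi>X = return borel (\<beta>RN (\<pi>Y y)))"
    then have "defect g = 0" for g using defect_eq_0_if_isomorphism[OF RX RY] by blast
    then show "furstenberg_entropy \<mu> actX \<nu>X = furstenberg_entropy \<mu> actY \<nu>Y"
      unfolding X.furstenberg_entropy_eq Y.furstenberg_entropy_eq gap_eq by simp
  qed
qed

end
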